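(* Let $k\ge 2$ be a fixed integer. For any $c,r>0$ there is a constant $C_{k,r,c}$, depending only on $k,r,c$, such that the following holds. Let $N\ge 2$ and $1\le n_1,\dots,n_k\le N$ be integers, let $A=(a_{\mathbf i})\in\mathbb R^{n_1\times\cdots\times n_k}$ be a deterministic tensor, and let $\Omega=(\omega_{\mathbf i})$ be a random tensor of the same dimensions with independent entries $\omega_{\mathbf i}\sim\mathrm{Bernoulli}(p_{\mathbf i})$, where $0\le p_{\mathbf i}\le 1$ for every $\mathbf i=(i_1,\dots,i_k)$. Put $p_*=\max_{\mathbf i}p_{\mathbf i}$. If $Np_*\ge c\log N$, then $$\mathbb P\left\{\|A\odot(\Omega-\mathbb E\Omega)\|>C_{k,r,c}\,\|A\|_\infty\sqrt{Np_*}\right\}\le N^{-r}.$$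
   Context: Here $\odot$ denotes entrywise multiplication and $\|A\|_\infty=\max_{\mathbf i}|a_{\mathbf i}|$. For a tensor $B=(b_{\mathbf i})\in\mathbb R^{n_1\times\cdots\times n_k}$ the spectral (injective) norm is $$\|B\|=\sup\Big\{\Big|\sum_{i_1=1}^{n_1}\cdots\sum_{i_k=1}^{n_k} b_{i_1,\dots,i_k}\prod_{j=1}^k x_{j,i_j}\Big|:\ x_j\in\mathbb R^{n_j},\ \|x_j\|_2=1\ (1\le j\le k)\Big\},$$ where $x_{j,i}$ is the $i$th coordinate of $x_j$. $\mathbb E\Omega$ is the entrywise mean, and $\log$ is the natural logarithm. *)

theory Defs
  imports "HOL-Probability.Probability"
begin

text \<open>A real tensor with dimensions \<open>n 1 \<times> \<dots> \<times> n k\<close> is a function on multi-indices of type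
  \<^typ>\<open>nat \<Rightarrow> nat\<close>; only its values on \<open>multi_index k n\<close> matter.\<close>

definition multi_index :: "nat \<Rightarrow> (nat \<Rightarrow> nat) \<Rightarrow> (nat \<Rightarrow> nat) set" where
  "multi_index k n = (\<Pi>\<^sub>E j\<in>{1..k}. {1..n j})"

definition spectral_norm :: "nat \<Rightarrow> (nat \<Rightarrow> nat) \<Rightarrow> ((nat \<Rightarrow> nat) \<Rightarrow> real) \<Rightarrow> real" where
  "spectral_norm k n B =
     (SUP x \<in> {x :: nat \<Rightarrow> nat \<Rightarrow> real. \<forall>j\<in>{1..k}. L2_set (x j) {1..n j} = 1}.
        \<bar>\<Sum>i\<in>multi_index k n. B i * (\<Prod>j\<in>{1..k}. x j (i j))\<bar>)"

definition max_norm :: "nat \<Rightarrow> (nat \<Rightarrow> nat) \<Rightarrow> ((nat \<Rightarrow> nat) \<Rightarrow> real) \<Rightarrow> real" where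
  "max_norm k n A = Max ((\<lambda>i. \<bar>A i\<bar>) ` multi_index k n)"

text \<open>The joint law of a random tensor whose entries are independent, the entry at \<open>i\<close> being
  Bernoulli with parameter \<open>p i\<close>. Entries are Booleans, read as \<open>0\<close> and \<open>1\<close> through
  \<^const>\<open>of_bool\<close>; outside the index set they are constantly \<^const>\<open>False\<close>. Using the law
  instead of a probability space of arbitrary type keeps the type of the sample space from
  occurring in a constant that may depend only on other parameters; by
  \<open>indep_bernoulli_tensor\<close> below nothing is lost.\<close>

definition bernoulli_tensor ::
    "nat \<Rightarrow> (nat \<Rightarrow> nat) \<Rightarrow> ((nat \<Rightarrow> nat) \<Rightarrow> real) \<Rightarrow> ((nat \<Rightarrow> nat) \<Rightarrow> bool) pmf" where
  "bernoulli_tensor k n p = Pi_pmf (multi_index k n) False (\<lambda>i. bernoulli_pmf (p i))"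

definition tensor_mean :: "((nat \<Rightarrow> nat) \<Rightarrow> bool) pmf \<Rightarrow> (nat \<Rightarrow> nat) \<Rightarrow> real" where
  "tensor_mean P i = measure_pmf.expectation P (\<lambda>\<omega>. of_bool (\<omega> i))"

lemma finite_multi_index: "finite (multi_index k n)"
  by (auto simp: multi_index_def intro!: finite_PiE)

lemma (in prob_space) indep_bernoulli_tensor:
  fixes k :: nat and n :: "nat \<Rightarrow> nat"
    and \<omega> :: "(nat \<Rightarrow> nat) \<Rightarrow> 'a \<Rightarrow> bool"
  defines "X \<equiv> (\<lambda>w i. i \<in> multi_index k n \<and> \<omega> i w)"
  assumes indep: "indep_vars (\<lambda>_. count_space UNIV) \<omega> (multi_index k n)"
    and law: "\<And>i. i \<in> multi_index k n \<Longrightarrow>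
      distr M (count_space UNIV) (\<omega> i) = measure_pmf (bernoulli_pmf (p i))"
  shows "prob {w \<in> space M. X w \<in> S} = measure_pmf.prob (bernoulli_tensor k n p) S"
proof -
  define I where "I = multi_index k n"
  have fin: "finite I" by (simp add: I_def finite_multi_index)
  define F where "F = {f :: (nat \<Rightarrow> nat) \<Rightarrow> bool. \<forall>i. i \<notin> I \<longrightarrow> \<not> f i}"
  have "F \<subseteq> (\<lambda>T i. i \<in> T) ` Pow I"
  proof
    fix f assume "f \<in> F"
    then have "f = (\<lambda>i. i \<in> {i. f i})" "{i. f i} \<in> Pow I" by (auto simp: F_def)
    then show "f \<in> (\<lambda>T i. i \<in> T) ` Pow I" by blast
  qed
  then have finF: "finite F" using fin by (meson finite_Pow_iff finite_imageI finite_subset)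
  have meas: "\<omega> i \<in> measurable M (count_space UNIV)" if "i \<in> I" for i
    using indep that by (auto simp: indep_vars_def I_def)
  have ev: "{w \<in> space M. X w = f} = {w \<in> space M. \<forall>i\<in>I. \<omega> i w = f i}" if "f \<in> F" for f
    using that by (auto simp: X_def F_def I_def fun_eq_iff)
  have sets: "{w \<in> space M. X w = f} \<in> sets M" if "f \<in> F" for f
    unfolding ev[OF that]
  proof (rule sets.sets_Collect_finite_All[OF _ fin])
    fix i assume "i \<in> I"
    then have "\<omega> i -` {f i} \<inter> space M \<in> sets M"
      by (intro measurable_sets[OF meas]) auto
    moreover have "\<omega> i -` {f i} \<inter> space M = {w \<in> space M. \<omega> i w = f i}" by auto
    ultimately show "{w \<in> space M. \<omega> i w = f i} \<in> sets M" by simp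
  qed
  have point: "prob {w \<in> space M. X w = f} = pmf (bernoulli_tensor k n p) f" if "f \<in> F" for f
  proof (cases "I = {}")
    case True
    then show ?thesis using that unfolding ev[OF that]
      by (auto simp: F_def bernoulli_tensor_def I_def[symmetric] prob_space fun_eq_iff)
  next
    case False
    have "prob {w \<in> space M. X w = f} = prob (\<Inter>i\<in>I. \<omega> i -` {f i} \<inter> space M)"
      unfolding ev[OF that] by (rule arg_cong[of _ _ prob]) (use False in auto)
    also have "\<dots> = (\<Prod>i\<in>I. prob (\<omega> i -` {f i} \<inter> space M))"
      by (rule indep_varsD_finite[OF indep[folded I_def] False fin]) auto
    also have "\<dots> = (\<Prod>i\<in>I. pmf (bernoulli_pmf (p i)) (f i))"
    proof (rule prod.cong[OF refl])
      fix i assume i: "i \<in> I"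
      have "prob (\<omega> i -` {f i} \<inter> space M) = measure (distr M (count_space UNIV) (\<omega> i)) {f i}"
        using meas[OF i] by (simp add: measure_distr)
      then show "prob (\<omega> i -` {f i} \<inter> space M) = pmf (bernoulli_pmf (p i)) (f i)"
        using law[of i] i by (simp add: I_def measure_pmf_single)
    qed
    also have "\<dots> = pmf (bernoulli_tensor k n p) f"
      using that fin unfolding bernoulli_tensor_def I_def[symmetric]
      by (subst pmf_Pi') (auto simp: F_def)
    finally show ?thesis .
  qed
  have XF: "X w \<in> F" for w by (auto simp: X_def F_def I_def)
  have "{w \<in> space M. X w \<in> S} = (\<Union>f\<in>S \<inter> F. {w \<in> space M. X w = f})"
    using XF by auto
  then have "prob {w \<in> space M. X w \<in> S} = (\<Sum>f\<in>S \<inter> F. prob {w \<in> space M. X w = f})"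
    using finF sets by (simp only:, intro finite_measure_finite_Union)
      (auto simp: disjoint_family_on_def)
  also have "\<dots> = (\<Sum>f\<in>S \<inter> F. pmf (bernoulli_tensor k n p) f)"
    by (intro sum.cong refl point) auto
  also have "\<dots> = measure_pmf.prob (bernoulli_tensor k n p) (S \<inter> F)"
    using finF by (simp add: measure_measure_pmf_finite)
  also have "\<dots> = measure_pmf.prob (bernoulli_tensor k n p) S"
  proof (rule measure_pmf.finite_measure_eq_AE)
    have "set_pmf (bernoulli_tensor k n p) \<subseteq> F"
      unfolding bernoulli_tensor_def I_def[symmetric] F_def
      using set_Pi_pmf_subset[OF fin] by fastforce
    then show "AE f in measure_pmf (bernoulli_tensor k n p). (f \<in> S \<inter> F) = (f \<in> S)"
      by (auto simp: AE_measure_pmf_iff)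
  qed auto
  finally show ?thesis .
qed

end

theory Submission
  imports Defs
begin

text \<open>
  This is the Kahn--Szemeredi argument. Let \<open>D = sqrt (N p\<^sub>*)\<close>. By multilinearity the vectors may be
  rounded to a lattice of mesh of order \<open>1 / sqrt N\<close>. The terms with \<open>\<bar>\<Prod>x\<^sub>j\<bar> \<le> D / N\<close> (light, up to
  constants) are handled by a Chernoff bound and a union bound over \<open>exp (O(N))\<close> lattice points. For
  the heavy terms the mean is harmless, and cancellation is not needed for the random part:
  \<open>\<bar>x\<^sub>j\<bar>\<close> is rounded up to a power of two, and a multi-index is sorted by its smallest factor
  \<open>1 / 2 ^ s\<close>. If the product exceeds \<open>D / 4 ^ s\<close>, the smallest factor is at most \<open>1 / D\<close> times the
  product of the others, and the term is absorbed by the bound \<open>O(N p\<^sub>*)\<close> on the number of ones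
  along any coordinate line; this is where \<open>N p\<^sub>* \<ge> c log N\<close> enters.
  Otherwise the product lies in \<open>(D / N, D / 4 ^ s]\<close>, and all entries that matter are at least
  \<open>1 / 2 ^ s\<close>. All such terms with the same \<open>s\<close> are treated at once, by a Chernoff bound with parameter
  \<open>L 4 ^ s / D\<close>, \<open>L = 1 + log (N / 4 ^ s)\<close>. The union bound is weighted by a prefix code for the large
  entries in which an entry \<open>1 / 2 ^ v\<close> costs \<open>2 L + (s - v) + 1\<close>; divided by the Chernoff parameter and
  summed over \<open>s \<ge> v\<close> this is \<open>O(D / 4 ^ v)\<close>, so that the total cost is \<open>O(D)\<close> times the squared norm.
  Grouping by \<open>s\<close> alone, rather than by the levels of all \<open>k\<close> factors, is what avoids
  logarithmic losses for \<open>k \<ge> 3\<close>.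
\<close>

section \<open>Auxiliary inequalities\<close>

lemma exp_quad_bound:
  fixes a :: real
  assumes "\<bar>a\<bar> \<le> 1"
  shows "exp a - 1 - a \<le> a\<^sup>2"
proof (cases "a \<ge> 0")
  case True
  then show ?thesis using exp_bound[of a] assms by simp
next
  case False
  define b where "b = - a"
  have b: "0 \<le> b" "b \<le> 1" using False assms by (auto simp: b_def)
  have "1 + b \<le> exp b" by (rule exp_ge_add_one_self)
  then have "exp (- b) \<le> 1 / (1 + b)"
    using b by (simp add: exp_minus field_simps)
  also have "\<dots> \<le> 1 - b + b\<^sup>2"
  proof -
    \<comment> \<open>The right-hand side is \<open>1 + b ^ 3\<close>.\<close>
    have "1 \<le> (1 - b + b\<^sup>2) * (1 + b)"
      using b by (simp add: algebra_simps power2_eq_square)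
    then show ?thesis using b by (simp add: pos_divide_le_eq)
  qed
  finally show ?thesis by (simp add: b_def)
qed

text \<open>This rearranges \<open>1 - y \<le> exp (- y)\<close>. Combined with a bound on
  \<open>exp y\<close> linear in \<open>y\<close>, the extra factor \<open>y\<close> makes the
  Chernoff exponents of the level sets quadratic in the terms.\<close>

lemma exp_minus_one_le_mult_exp:
  fixes y :: real
  shows "exp y - 1 \<le> y * exp y"
proof -
  have "(1 - y) * exp y \<le> exp (- y) * exp y"
    using exp_ge_add_one_self[of "- y"] by (intro mult_right_mono) auto
  then show ?thesis by (simp add: exp_minus algebra_simps)
qed

text \<open>The function \<open>exp y / y\<close> is quasiconvex, so it is bounded by its values at the endpoints.\<close>

lemma exp_div_le_exp_div:
  fixes y L :: real
  assumes "L \<ge> 1" "y \<le> L" "L * exp (1 - L) \<le> y"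
  shows "exp y \<le> y * exp L / L"
proof -
  have y0: "0 < y" using assms(1,3) by (smt (verit) exp_gt_zero mult_pos_pos)
  show ?thesis
  proof (cases "y \<ge> 1")
    case True
    have "ln L - ln y \<le> L - y"
    proof -
      have "ln L - ln y = ln (L / y)" using y0 assms by (simp add: ln_div)
      also have "\<dots> \<le> L / y - 1" using y0 assms by (intro ln_le_minus_one) auto
      also have "\<dots> = (L - y) / y" using y0 by (simp add: field_simps)
      also have "\<dots> \<le> L - y" using True assms by (simp add: divide_le_eq mult_le_cancel_left1)
      finally show ?thesis .
    qed
    then have "exp (y + ln L) \<le> exp (L + ln y)" by simp
    then have "exp y * L \<le> exp L * y" using y0 assms by (simp add: exp_add)
    then show ?thesis using assms by (simp add: pos_le_divide_eq mult.commute)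
  next
    case False
    have "exp y \<le> exp 1" using False by simp
    \<comment> \<open>The lower end of the range for \<open>y\<close> is the value at which
      \<open>y * exp L / L\<close> equals \<open>exp 1\<close>.\<close>
    also have "\<dots> = (L * exp (1 - L)) * exp L / L"
      using assms by (simp add: exp_diff)
    also have "\<dots> \<le> y * exp L / L"
      using assms by (intro divide_right_mono mult_right_mono) auto
    finally show ?thesis .
  qed
qed

text \<open>Prefix-code weights \<open>exp (- c x)\<close> let a union bound pay \<open>c x\<close> for the object \<open>x\<close>.\<close>

lemma chernoff_union_bound:
  fixes M :: "'a pmf" and F :: "'x \<Rightarrow> 'a \<Rightarrow> real" and \<Psi> c :: "'x \<Rightarrow> real"
  assumes "finite X" "finite (set_pmf M)"
    and mgf: "\<And>x. x \<in> X \<Longrightarrow> measure_pmf.expectation M (\<lambda>\<omega>. exp (F x \<omega>)) \<le> exp (\<Psi> x)"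
    and kraft: "(\<Sum>x\<in>X. exp (- c x)) \<le> K"
  shows "measure_pmf.prob M {\<omega>. \<exists>x\<in>X. F x \<omega> > \<Psi> x + c x + t} \<le> K * exp (- t)"
proof -
  have int: "integrable (measure_pmf M) f" for f :: "'a \<Rightarrow> real"
    by (rule integrable_measure_pmf_finite) fact
  have single: "measure_pmf.prob M {\<omega>. F x \<omega> > \<Psi> x + c x + t} \<le> exp (- c x) * exp (- t)"
    if x: "x \<in> X" for x
  proof -
    have "measure_pmf.prob M {\<omega>. F x \<omega> > \<Psi> x + c x + t}
        \<le> measure_pmf.prob M {\<omega> \<in> space M. exp (F x \<omega>) \<ge> exp (\<Psi> x + c x + t)}"
      by (intro measure_pmf.finite_measure_mono) auto
    also have "\<dots> \<le> measure_pmf.expectation M (\<lambda>\<omega>. exp (F x \<omega>)) / exp (\<Psi> x + c x + t)"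
      by (rule integral_Markov_inequality_measure[where A = "{}"]) (auto simp: int)
    also have "\<dots> \<le> exp (\<Psi> x) / exp (\<Psi> x + c x + t)"
      using mgf[OF x] by (intro divide_right_mono) auto
    also have "\<dots> = exp (- c x) * exp (- t)" by (simp add: exp_add exp_minus field_simps)
    finally show ?thesis .
  qed
  have "{\<omega>. \<exists>x\<in>X. F x \<omega> > \<Psi> x + c x + t} = (\<Union>x\<in>X. {\<omega>. F x \<omega> > \<Psi> x + c x + t})" by auto
  then have "measure_pmf.prob M {\<omega>. \<exists>x\<in>X. F x \<omega> > \<Psi> x + c x + t}
      \<le> (\<Sum>x\<in>X. measure_pmf.prob M {\<omega>. F x \<omega> > \<Psi> x + c x + t})"
    using assms(1) by (auto intro!: measure_pmf.finite_measure_subadditive_finite)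
  also have "\<dots> \<le> (\<Sum>x\<in>X. exp (- c x) * exp (- t))"
    by (intro sum_mono single)
  also have "\<dots> \<le> K * exp (- t)"
    using kraft by (simp flip: sum_distrib_right)
  finally show ?thesis .
qed

text \<open>The absolute value of an affine function on an interval is largest at an endpoint, so
  the coordinates can be pushed to endpoints one after another. This rounds vectors to a lattice
  with no approximation error in the form.\<close>

lemma multiaffine_le_vertex:
  fixes f :: "('a \<Rightarrow> real) \<Rightarrow> real"
  assumes "finite J"
    and affine: "\<And>u x. x \<in> J \<Longrightarrow> \<exists>a b. \<forall>t. f (u(x := t)) = a + b * t"
    and "\<And>x. x \<in> J \<Longrightarrow> lo x \<le> u x \<and> u x \<le> hi x"
  shows "\<exists>v. (\<forall>x\<in>J. v x = lo x \<or> v x = hi x) \<and> (\<forall>x. x \<notin> J \<longrightarrow> v x = u x) \<and> \<bar>f u\<bar> \<le> \<bar>f v\<bar>"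
  using assms
proof (induction J arbitrary: u rule: finite_induct)
  case empty
  then show ?case by auto
next
  case (insert x J)
  obtain v where v: "\<forall>y\<in>J. v y = lo y \<or> v y = hi y" "\<forall>y. y \<notin> J \<longrightarrow> v y = u y" "\<bar>f u\<bar> \<le> \<bar>f v\<bar>"
    using insert.IH[of u] insert.prems by blast
  obtain a b where ab: "\<And>t. f (v(x := t)) = a + b * t" using insert.prems(1)[of x v] by blast
  have vx: "v x = u x" "lo x \<le> u x" "u x \<le> hi x" using v(2) insert by auto
  have fv: "f v = a + b * u x" by (metis ab fun_upd_triv vx(1))
  have "\<bar>a + b * u x\<bar> \<le> \<bar>a + b * lo x\<bar> \<or> \<bar>a + b * u x\<bar> \<le> \<bar>a + b * hi x\<bar>"
  proof (cases "b \<ge> 0")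
    case True
    then have "b * lo x \<le> b * u x" "b * u x \<le> b * hi x" using vx by (auto intro: mult_left_mono)
    then show ?thesis by linarith
  next
    case False
    then have "b * u x \<le> b * lo x" "b * hi x \<le> b * u x" using vx by (auto intro: mult_left_mono_neg)
    then show ?thesis by linarith
  qed
  then obtain t where t: "t = lo x \<or> t = hi x" "\<bar>f v\<bar> \<le> \<bar>f (v(x := t))\<bar>"
    unfolding fv ab by blast
  show ?case
  proof (intro exI conjI)
    show "\<bar>f u\<bar> \<le> \<bar>f (v(x := t))\<bar>" using v(3) t(2) by linarith
  qed (use v t(1) insert.hyps in auto)
qed

lemma sum_PiE_insert:
  assumes "x \<notin> S"
  shows "(\<Sum>g\<in>Pi\<^sub>E (insert x S) T. f g) = (\<Sum>g\<in>Pi\<^sub>E S T. \<Sum>y\<in>T x. f (g(x := y)))"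
proof -
  have "(\<Sum>g\<in>Pi\<^sub>E (insert x S) T. f g) = (\<Sum>(y, g)\<in>T x \<times> Pi\<^sub>E S T. f (g(x := y)))"
    unfolding PiE_insert_eq
    by (subst sum.reindex[OF inj_combinator[OF assms]]) (simp add: case_prod_beta)
  also have "\<dots> = (\<Sum>y\<in>T x. \<Sum>g\<in>Pi\<^sub>E S T. f (g(x := y)))"
    by (simp add: sum.cartesian_product)
  also have "\<dots> = (\<Sum>g\<in>Pi\<^sub>E S T. \<Sum>y\<in>T x. f (g(x := y)))" by (rule sum.swap)
  finally show ?thesis .
qed

section \<open>Geometric sums, dyadic scales and lattice weights\<close>

lemma sum_powers_le:
  fixes x :: real
  assumes "0 \<le> x" "x < 1" "finite A"
  shows "(\<Sum>d\<in>A. x ^ d) \<le> 1 / (1 - x)"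
proof -
  have "(\<Sum>d\<in>A. x ^ d) \<le> (\<Sum>d. x ^ d)"
    using assms by (intro sum_le_suminf summable_geometric) auto
  then show ?thesis using assms by (simp add: suminf_geometric)
qed

lemma three_plus_le: "3 + real d \<le> 3 * 2 ^ d"
  by (induction d) auto

lemma sum_halves_le: "finite A \<Longrightarrow> (\<Sum>d\<in>A. (1/2 :: real) ^ d) \<le> 2"
  using sum_powers_le[of "1/2" A] by simp

text \<open>The scale \<open>1 / 2 ^ S\<close> of the rounding lattice: fine enough to perturb a vector of length \<open>N\<close>
  by at most \<open>1/4\<close>, coarse enough that the lattice has only \<open>exp (O(N))\<close> points in the ball.\<close>

lemma dyadic_scale_exists:
  fixes N :: nat
  assumes "N \<ge> 1"
  shows "\<exists>S. 16 * real N \<le> 4 ^ S \<and> 4 ^ S \<le> 64 * real N"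
proof -
  have ex: "16 * real N \<le> 4 ^ (16 * N)"
  proof -
    have "16 * N < 4 ^ (16 * N)" by (rule less_exp[THEN less_le_trans]) (simp add: power_mono)
    then have "real (16 * N) < real (4 ^ (16 * N))" by (simp only: of_nat_less_iff)
    then show ?thesis by simp
  qed
  define S where "S = (LEAST S. 16 * real N \<le> 4 ^ S)"
  have S: "16 * real N \<le> 4 ^ S" unfolding S_def by (rule LeastI[of _ "16 * N"]) (rule ex)
  have "S \<noteq> 0" using S assms by (intro notI) simp
  then obtain S' where S': "S = Suc S'" by (cases S) auto
  have "\<not> 16 * real N \<le> 4 ^ S'" using not_less_Least[of S' "\<lambda>S. 16 * real N \<le> 4 ^ S"] S'
    unfolding S_def by simp
  then have "4 ^ S \<le> 64 * real N" using S' by simp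
  with S show ?thesis by blast
qed

text \<open>A nonzero lattice coordinate has modulus between \<open>1 / 2 ^ S\<close> and 1, so
  levels from 0 to \<open>S\<close> suffice. The level is \<open>S - e\<close> for the least
  \<open>e\<close> with \<open>\<bar>z\<bar> \<le> 2 ^ e\<close>.\<close>

lemma dyadic_round_up:
  fixes z :: int
  assumes "z \<noteq> 0" "\<bar>z\<bar> \<le> 2 ^ S"
  shows "\<exists>l\<le>S. \<bar>real_of_int z\<bar> / 2 ^ S \<le> (1/2) ^ l \<and> (1/2) ^ l \<le> 2 * (\<bar>real_of_int z\<bar> / 2 ^ S)"
proof -
  define e where "e = (LEAST e. \<bar>z\<bar> \<le> 2 ^ e)"
  have e: "\<bar>z\<bar> \<le> 2 ^ e" unfolding e_def by (rule LeastI[of _ S]) fact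
  have eS: "e \<le> S" unfolding e_def by (rule Least_le) fact
  have e2: "2 ^ e \<le> 2 * \<bar>z\<bar>"
  proof (cases e)
    case 0
    then show ?thesis using assms by simp
  next
    case (Suc e')
    then have "\<not> \<bar>z\<bar> \<le> 2 ^ e'" using not_less_Least[of e' "\<lambda>e. \<bar>z\<bar> \<le> 2 ^ e"] unfolding e_def by simp
    then show ?thesis using Suc by simp
  qed
  have r1: "\<bar>real_of_int z\<bar> \<le> 2 ^ e" using e by (metis of_int_abs of_int_le_iff of_int_numeral of_int_power)
  have "real_of_int (2 ^ e) \<le> real_of_int (2 * \<bar>z\<bar>)" using e2 by (simp only: of_int_le_iff)
  then have r2: "2 ^ e \<le> 2 * \<bar>real_of_int z\<bar>" by simp
  have eq: "(1/2::real) ^ (S - e) = 2 ^ e / 2 ^ S"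
    using eS by (simp add: power_diff power_one_over field_simps)
  have "\<bar>real_of_int z\<bar> / 2 ^ S \<le> (1/2) ^ (S - e)" "(1/2) ^ (S - e) \<le> 2 * \<bar>real_of_int z\<bar> / 2 ^ S"
    unfolding eq using r1 r2 by (intro divide_right_mono; simp)+
  then show ?thesis by (intro exI[of _ "S - e"]) simp
qed


lemma exp_neg_nat_le: "exp (- real d) \<le> (1/2) ^ d"
proof -
  have "exp (- 1 :: real) \<le> 1/2"
    using exp_ge_add_one_self[of "1::real"] by (simp add: exp_minus field_simps)
  then have "exp (- 1 :: real) ^ d \<le> (1/2) ^ d" by (intro power_mono) auto
  then show ?thesis by (simp flip: exp_of_nat_mult)
qed

text \<open>Kraft sum of one lattice coordinate when the value \<open>z\<close> costs
  \<open>\<bar>z\<bar>\<close> in the union bound.\<close>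

lemma sum_exp_neg_abs_le:
  fixes M :: int
  shows "(\<Sum>z\<in>{-M..M}. exp (- real_of_int \<bar>z\<bar>)) \<le> 4"
proof -
  define f where "f z = exp (- real_of_int \<bar>z\<bar>)" for z :: int
  let ?A = "int ` {..nat M}" and ?B = "(\<lambda>d. - int d) ` {..nat M}"
  have half: "(\<Sum>d\<le>nat M. exp (- real d)) \<le> 2"
    using sum_powers_le[of "1/2" "{..nat M}"] sum_mono[of "{..nat M}" "\<lambda>d. exp (- real d)" "\<lambda>d. (1/2) ^ d"] exp_neg_nat_le
    by fastforce
  \<comment> \<open>Both half-lines contain 0; counting it twice only weakens the constant.\<close>
  have "{-M..M} \<subseteq> ?A \<union> ?B"
  proof
    fix z assume "z \<in> {-M..M}"
    then have "z = int (nat z) \<and> nat z \<le> nat M \<or> z = - int (nat (- z)) \<and> nat (- z) \<le> nat M" by auto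
    then show "z \<in> ?A \<union> ?B" by blast
  qed
  then have "sum f {-M..M} \<le> sum f (?A \<union> ?B)"
    by (intro sum_mono2) (auto simp: f_def)
  also have "\<dots> \<le> sum f ?A + sum f ?B"
    using sum.union_inter[of ?A ?B f] sum_nonneg[of "?A \<inter> ?B" f] by (auto simp: f_def)
  also have "sum f ?A = (\<Sum>d\<le>nat M. exp (- real d))"
    by (subst sum.reindex) (auto simp: f_def inj_on_def)
  also have "sum f ?B = (\<Sum>d\<le>nat M. exp (- real d))"
    by (subst sum.reindex) (auto simp: f_def inj_on_def)
  finally show ?thesis using half by (simp add: f_def)
qed

section \<open>Exponential moments of a sparse tensor\<close>

text \<open>Here \<open>q\<close> stands for the maximal probability, and \<open>1 / 2 ^ S\<close>
  is the mesh of the rounding lattice.\<close>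

locale sparse_tensor =
  fixes k N S :: nat and n :: "nat \<Rightarrow> nat" and p :: "(nat \<Rightarrow> nat) \<Rightarrow> real" and q :: real
  assumes k_ge: "1 \<le> k" and N_ge: "2 \<le> N"
    and n_le: "\<And>j. j \<in> {1..k} \<Longrightarrow> n j \<le> N"
    and p_bounds: "\<And>i. i \<in> multi_index k n \<Longrightarrow> 0 \<le> p i \<and> p i \<le> 1 \<and> p i \<le> q"
    and q_pos: "0 < q"
    and S_lower: "16 * real N \<le> 4 ^ S" and S_upper: "4 ^ S \<le> 64 * real N"
begin

definition I :: "(nat \<Rightarrow> nat) set" where "I = multi_index k n"
text \<open>The coordinates of all \<open>k\<close> vectors form one disjoint union, so that a tuple
  of vectors is a single function on \<open>J\<close> and rounding and coding can treat it as one
  object.\<close>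

definition J :: "(nat \<times> nat) set" where "J = Sigma {1..k} (\<lambda>j. {1..n j})"
definition P :: "((nat \<Rightarrow> nat) \<Rightarrow> bool) pmf" where "P = bernoulli_tensor k n p"
definition D :: real where "D = sqrt (real N * q)"
text \<open>As \<open>4 ^ S\<close> is comparable to \<open>N\<close>, this is \<open>D / N\<close>
  up to a constant. The power of 4 makes its ratio to the thresholds \<open>D / 4 ^ s\<close> of the
  level sets an exact power.\<close>

definition \<tau> :: real where "\<tau> = D / 4 ^ S"

lemma finite_I: "finite I"
  by (simp add: I_def finite_multi_index)

lemma finite_J: "finite J"
  by (auto simp: J_def)

lemma card_J: "real (card J) \<le> real k * real N"
proof -
  have "card J = (\<Sum>j\<in>{1..k}. n j)" by (simp add: J_def)
  also have "\<dots> \<le> (\<Sum>j\<in>{1..k}. N)" by (intro sum_mono n_le) auto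
  finally show ?thesis by (simp flip: of_nat_mult)
qed

lemma D_pos: "0 < D"
  using N_ge q_pos by (simp add: D_def)

lemma D_sq: "D * D = real N * q"
  using N_ge q_pos by (simp add: D_def)

lemma N_le: "real N \<le> 4 ^ S"
  using S_lower by linarith

lemma tau_pos: "0 < \<tau>"
  using D_pos by (simp add: \<tau>_def)

text \<open>Trades \<open>q\<close> for \<open>D\<close>, since \<open>D * D = N * q\<close> and
  \<open>4 ^ S\<close> is at most \<open>64 * N\<close>. The light terms, the means of the heavy
  terms and the level sets all get their constant 64 from here.\<close>

lemma q_scale_le: "q * 4 ^ S / D \<le> 64 * D"
proof -
  have "q * 4 ^ S \<le> q * (64 * real N)" using S_upper q_pos by simp
  also have "\<dots> = 64 * D * D" using D_sq by (simp add: algebra_simps)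
  finally show ?thesis using D_pos by (simp add: pos_divide_le_eq)
qed

lemma index_mem_J: "i \<in> I \<Longrightarrow> j \<in> {1..k} \<Longrightarrow> (j, i j) \<in> J"
  by (auto simp: I_def J_def multi_index_def PiE_def Pi_def)

lemma finite_set_P: "finite (set_pmf P)"
proof -
  have "finite (multi_index k n)" by (rule finite_multi_index)
  then show ?thesis unfolding P_def bernoulli_tensor_def
    by (subst set_Pi_pmf) (auto intro!: finite_PiE_dflt)
qed

lemma tensor_mean_eq:
  assumes "i \<in> I"
  shows "tensor_mean P i = p i"
proof -
  have "tensor_mean P i = measure_pmf.expectation (map_pmf (\<lambda>f. f i) P) (\<lambda>b. of_bool b)"
    by (simp add: tensor_mean_def)
  also have "map_pmf (\<lambda>f. f i) P = bernoulli_pmf (p i)"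
    using assms finite_I unfolding P_def bernoulli_tensor_def I_def[symmetric]
    by (subst Pi_pmf_component) auto
  also have "measure_pmf.expectation (bernoulli_pmf (p i)) (\<lambda>b. of_bool b :: real) = p i"
    using p_bounds[of i] assms by (simp add: I_def)
  finally show ?thesis .
qed

lemma sum_prod_eq: "(\<Sum>i\<in>I. \<Prod>j\<in>{1..k}. (f j (i j) :: real)) = (\<Prod>j\<in>{1..k}. \<Sum>m\<in>{1..n j}. f j m)"
  unfolding I_def multi_index_def by (subst prod_sum_PiE) auto

lemma sum_prod_le_one:
  assumes "\<And>j m. 0 \<le> f j m" "\<And>j. j \<in> {1..k} \<Longrightarrow> (\<Sum>m\<in>{1..n j}. f j m) \<le> (1 :: real)"
  shows "(\<Sum>i\<in>I. \<Prod>j\<in>{1..k}. f j (i j)) \<le> 1"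
  unfolding sum_prod_eq by (intro prod_le_1 conjI sum_nonneg assms)

lemma mgf_sum:
  assumes "I' \<subseteq> I"
  shows "measure_pmf.expectation P (\<lambda>\<omega>. exp (\<Sum>i\<in>I'. a i * of_bool (\<omega> i)))
    \<le> exp (\<Sum>i\<in>I'. p i * (exp (a i) - 1))"
proof -
  \<comment> \<open>Extending the coefficients by zero lets independence be applied over the whole
    index set.\<close>
  define b where "b = (\<lambda>i. if i \<in> I' then a i else 0)"
  have pb: "0 \<le> p i" "p i \<le> 1" if "i \<in> I" for i using p_bounds[of i] that by (auto simp: I_def)
  have eq: "exp (\<Sum>i\<in>I'. a i * of_bool (\<omega> i)) = (\<Prod>i\<in>I. exp (b i * of_bool (\<omega> i)))" for \<omega>
  proof -
    have "(\<Sum>i\<in>I'. a i * of_bool (\<omega> i)) = (\<Sum>i\<in>I. b i * of_bool (\<omega> i))"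
      using assms finite_I by (intro sum.mono_neutral_cong_left) (auto simp: b_def)
    then show ?thesis by (simp only: exp_sum[OF finite_I])
  qed
  have "measure_pmf.expectation P (\<lambda>\<omega>. exp (\<Sum>i\<in>I'. a i * of_bool (\<omega> i)))
      = (\<Prod>i\<in>I. measure_pmf.expectation (bernoulli_pmf (p i)) (\<lambda>v. exp (b i * of_bool v)))"
    unfolding eq P_def bernoulli_tensor_def I_def[symmetric]
    by (rule expectation_prod_Pi_pmf) (auto simp: finite_I intro: integrable_measure_pmf_finite)
  also have "\<dots> = (\<Prod>i\<in>I. 1 + p i * (exp (b i) - 1))"
    by (intro prod.cong refl) (simp add: pb algebra_simps)
  also have "\<dots> \<le> (\<Prod>i\<in>I. exp (p i * (exp (b i) - 1)))"
  proof (rule prod_mono)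
    fix i assume i: "i \<in> I"
    have "0 \<le> (1 - p i) + p i * exp (b i)" using pb[OF i] by simp
    then show "0 \<le> 1 + p i * (exp (b i) - 1) \<and> 1 + p i * (exp (b i) - 1) \<le> exp (p i * (exp (b i) - 1))"
      using exp_ge_add_one_self[of "p i * (exp (b i) - 1)"] by (simp add: algebra_simps)
  qed
  also have "\<dots> = exp (\<Sum>i\<in>I. p i * (exp (b i) - 1))" using finite_I by (simp add: exp_sum)
  also have "(\<Sum>i\<in>I. p i * (exp (b i) - 1)) = (\<Sum>i\<in>I'. p i * (exp (a i) - 1))"
    using assms finite_I by (intro sum.mono_neutral_cong_right) (auto simp: b_def)
  finally show ?thesis .
qed

text \<open>Centring cancels the linear term of \<open>exp (a i) - 1\<close>, and what is left is
  quadratic when \<open>\<bar>a i\<bar> \<le> 1\<close>.\<close>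

lemma mgf_centered_sum:
  assumes "I' \<subseteq> I" "\<And>i. i \<in> I' \<Longrightarrow> \<bar>a i\<bar> \<le> 1"
  shows "measure_pmf.expectation P (\<lambda>\<omega>. exp (\<Sum>i\<in>I'. a i * (of_bool (\<omega> i) - p i)))
    \<le> exp (\<Sum>i\<in>I'. p i * (a i)\<^sup>2)"
proof -
  have eq: "exp (\<Sum>i\<in>I'. a i * (of_bool (\<omega> i) - p i))
      = exp (- (\<Sum>i\<in>I'. a i * p i)) * exp (\<Sum>i\<in>I'. a i * of_bool (\<omega> i))" for \<omega>
    by (simp add: exp_add[symmetric] right_diff_distrib sum_subtractf)
  have "measure_pmf.expectation P (\<lambda>\<omega>. exp (\<Sum>i\<in>I'. a i * (of_bool (\<omega> i) - p i)))
      \<le> exp (- (\<Sum>i\<in>I'. a i * p i)) * exp (\<Sum>i\<in>I'. p i * (exp (a i) - 1))"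
    unfolding eq using mgf_sum[OF assms(1), of a] by simp
  also have "\<dots> = exp (\<Sum>i\<in>I'. p i * (exp (a i) - 1 - a i))"
    by (simp add: exp_add[symmetric] algebra_simps sum_subtractf sum.distrib)
  also have "\<dots> \<le> exp (\<Sum>i\<in>I'. p i * (a i)\<^sup>2)"
    using p_bounds assms by (auto simp: I_def intro!: sum_mono mult_left_mono exp_quad_bound)
  finally show ?thesis .
qed


section \<open>Light multi-indices\<close>

definition \<theta> :: "(nat \<times> nat \<Rightarrow> int) \<Rightarrow> nat \<times> nat \<Rightarrow> real" where
  "\<theta> z x = real_of_int (z x) / 2 ^ S"

text \<open>The vectors have norm at most 1/2 instead of 1, so that rounding their entries up to
  powers of two, which at most doubles them, still gives norm at most 1.\<close>

definition Z :: "(nat \<times> nat \<Rightarrow> int) set" where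
  "Z = {z \<in> Pi\<^sub>E J (\<lambda>_. {- (2 ^ S)..2 ^ S}). \<forall>j\<in>{1..k}. (\<Sum>m\<in>{1..n j}. (\<theta> z (j, m))\<^sup>2) \<le> 1/4}"

definition light :: "(nat \<times> nat \<Rightarrow> int) \<Rightarrow> (nat \<Rightarrow> nat) set" where
  "light z = {i \<in> I. \<bar>\<Prod>j\<in>{1..k}. \<theta> z (j, i j)\<bar> \<le> \<tau>}"

lemma finite_Z: "finite Z"
proof -
  have "finite (Pi\<^sub>E J (\<lambda>_. {- (2 ^ S)..2 ^ S :: int}))" by (intro finite_PiE finite_J) auto
  then show ?thesis by (simp add: Z_def)
qed

lemma sum_prod_theta_sq_le_one:
  assumes "z \<in> Z" "I' \<subseteq> I"
  shows "(\<Sum>i\<in>I'. (\<Prod>j\<in>{1..k}. \<theta> z (j, i j))\<^sup>2) \<le> 1"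
proof -
  have "(\<Sum>i\<in>I'. (\<Prod>j\<in>{1..k}. \<theta> z (j, i j))\<^sup>2) \<le> (\<Sum>i\<in>I. (\<Prod>j\<in>{1..k}. \<theta> z (j, i j))\<^sup>2)"
    using assms finite_I by (intro sum_mono2) auto
  also have "\<dots> \<le> 1"
    unfolding prod_power_distrib
  proof (rule sum_prod_le_one[where f = "\<lambda>j m. (\<theta> z (j, m))\<^sup>2"])
    fix j assume "j \<in> {1..k}"
    then have "(\<Sum>m\<in>{1..n j}. (\<theta> z (j, m))\<^sup>2) \<le> 1/4" using assms by (simp add: Z_def)
    then show "(\<Sum>m\<in>{1..n j}. (\<theta> z (j, m))\<^sup>2) \<le> 1" by simp
  qed auto
  finally show ?thesis .
qed

lemma sum_J: "(\<Sum>x\<in>J. f x) = (\<Sum>j\<in>{1..k}. \<Sum>m\<in>{1..n j}. f (j, m))"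
  unfolding J_def by (subst sum.Sigma) auto

text \<open>Chernoff bound with parameter \<open>1 / \<tau>\<close>. The variance contributes at
  most \<open>64 * 4 ^ S\<close>, and a lattice point \<open>z\<close> costs the sum of its
  \<open>\<bar>z x\<bar>\<close>, at most \<open>k / 4 * 4 ^ S\<close>. Both are of order
  \<open>N\<close>, and dividing by the parameter leaves order \<open>D\<close>.\<close>

lemma light_event:
  fixes A :: "(nat \<Rightarrow> nat) \<Rightarrow> real"
  assumes A: "\<And>i. i \<in> I \<Longrightarrow> \<bar>A i\<bar> \<le> 1" and R: "0 \<le> R"
  shows "measure_pmf.prob P {\<omega>. \<exists>z\<in>Z.
      \<bar>\<Sum>i\<in>light z. A i * (of_bool (\<omega> i) - p i) * (\<Prod>j\<in>{1..k}. \<theta> z (j, i j))\<bar> > (64 + 3 * real k + R) * D}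
    \<le> 2 * exp (- R * ln (real N))"
proof -
  define W :: real where "W = 4 ^ S"
  \<comment> \<open>This is \<open>1 / \<tau>\<close>, which scales every light term to modulus at
    most 1, as \<open>mgf_centered_sum\<close> demands.\<close>
  define \<mu> where "\<mu> = W / D"
  have W: "W > 0" "16 * real N \<le> W" "W \<le> 64 * real N" using S_lower S_upper by (auto simp: W_def)
  have N0: "real N > 0" using N_ge by simp
  have \<mu>: "\<mu> > 0" "\<mu> * \<tau> = 1" using W D_pos by (auto simp: \<mu>_def \<tau>_def W_def)
  define T where "T = (\<lambda>z i. \<Prod>j\<in>{1..k}. \<theta> z (j, i j))"
  \<comment> \<open>The sign \<open>e\<close> handles both tails in one union bound.\<close>
  define F where "F = (\<lambda>(z, e::real) \<omega>. \<Sum>i\<in>light z. (e * \<mu> * A i * T z i) * (of_bool (\<omega> i) - p i))"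
  define c where "c = (\<lambda>(z :: nat \<times> nat \<Rightarrow> int, e :: real). \<Sum>x\<in>J. real_of_int \<bar>z x\<bar>)"
  \<comment> \<open>The part \<open>2 * k * N\<close> pays for the Kraft sum below; the part
    \<open>R * N\<close> gives the probability.\<close>
  define t where "t = (2 * real k + R) * real N"
  have mgf: "measure_pmf.expectation P (\<lambda>\<omega>. exp (F x \<omega>)) \<le> exp (64 * W)"
    if x: "x \<in> Z \<times> {1, -1}" for x
  proof -
    obtain z e where xe: "x = (z, e)" "z \<in> Z" "\<bar>e\<bar> = 1" using x by auto
    have le1: "\<bar>e * \<mu> * A i * T z i\<bar> \<le> 1" if "i \<in> light z" for i
    proof -
      have i: "i \<in> I" "\<bar>T z i\<bar> \<le> \<tau>" using that by (auto simp: light_def T_def)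
      have "\<bar>e * \<mu> * A i * T z i\<bar> = \<mu> * (\<bar>A i\<bar> * \<bar>T z i\<bar>)" using xe \<mu> by (simp add: abs_mult)
      also have "\<dots> \<le> \<mu> * (1 * \<tau>)"
        using A[OF i(1)] i \<mu> by (intro mult_left_mono mult_mono) auto
      finally show ?thesis using \<mu> by simp
    qed
    have "measure_pmf.expectation P (\<lambda>\<omega>. exp (F x \<omega>))
        \<le> exp (\<Sum>i\<in>light z. p i * (e * \<mu> * A i * T z i)\<^sup>2)"
      unfolding xe(1) F_def prod.case by (rule mgf_centered_sum) (use le1 in \<open>auto simp: light_def\<close>)
    also have "(\<Sum>i\<in>light z. p i * (e * \<mu> * A i * T z i)\<^sup>2) \<le> (\<Sum>i\<in>light z. (q * \<mu>\<^sup>2) * (T z i)\<^sup>2)"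
    proof (rule sum_mono)
      fix i assume "i \<in> light z"
      then have i: "i \<in> I" by (simp add: light_def)
      have "e\<^sup>2 = 1" using xe(3) by (metis one_power2 power2_abs)
      moreover have "(A i)\<^sup>2 \<le> 1" using A[OF i] by (simp add: abs_square_le_1)
      ultimately have "(e * \<mu> * A i * T z i)\<^sup>2 \<le> \<mu>\<^sup>2 * (T z i)\<^sup>2"
        by (simp add: power_mult_distrib mult_left_le_one_le mult_left_le mult_right_mono)
      then have "p i * (e * \<mu> * A i * T z i)\<^sup>2 \<le> q * (\<mu>\<^sup>2 * (T z i)\<^sup>2)"
        using p_bounds[of i] i q_pos by (intro mult_mono) (auto simp: I_def)
      then show "p i * (e * \<mu> * A i * T z i)\<^sup>2 \<le> (q * \<mu>\<^sup>2) * (T z i)\<^sup>2" by (simp add: mult.assoc)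
    qed
    also have "\<dots> \<le> (q * \<mu>\<^sup>2) * 1"
      unfolding sum_distrib_left[symmetric] T_def using q_pos
      by (intro mult_left_mono sum_prod_theta_sq_le_one xe) (auto simp: light_def)
    also have "\<dots> = W * (q * W / D / D)" by (simp add: \<mu>_def power2_eq_square)
    also have "\<dots> \<le> W * 64"
    proof (rule mult_left_mono)
      have "q * W / D / D \<le> 64 * D / D"
        using q_scale_le D_pos unfolding W_def by (intro divide_right_mono) auto
      then show "q * W / D / D \<le> 64" using D_pos by simp
    qed (use W in simp)
    finally show ?thesis by (simp add: mult.commute)
  qed
  have kraft: "(\<Sum>x\<in>Z \<times> {1, -1}. exp (- c x)) \<le> 2 * exp (2 * real k * real N)"
  proof -
    have "(\<Sum>x\<in>Z \<times> {1, -1}. exp (- c x)) = (\<Sum>z\<in>Z. \<Sum>e\<in>{1, -1}. exp (- c (z, e)))"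
      by (subst sum.cartesian_product) (simp add: case_prod_unfold)
    also have "\<dots> = 2 * (\<Sum>z\<in>Z. \<Prod>x\<in>J. exp (- real_of_int \<bar>z x\<bar>))"
      by (simp add: c_def exp_sum[OF finite_J, symmetric] sum_negf sum_distrib_left)
    also have "(\<Sum>z\<in>Z. \<Prod>x\<in>J. exp (- real_of_int \<bar>z x\<bar>))
        \<le> (\<Sum>z\<in>Pi\<^sub>E J (\<lambda>_. {- (2 ^ S)..2 ^ S}). \<Prod>x\<in>J. exp (- real_of_int \<bar>z x\<bar>))"
      by (intro sum_mono2 finite_PiE finite_J) (auto simp: Z_def intro!: prod_nonneg)
    also have "\<dots> = (\<Prod>x\<in>J. \<Sum>z\<in>{- (2 ^ S)..2 ^ S}. exp (- real_of_int \<bar>z\<bar>))"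
      by (rule prod_sum_PiE[symmetric]) (auto simp: finite_J)
    also have "\<dots> \<le> (\<Prod>x\<in>J. exp 2)"
    proof (intro prod_mono conjI)
      have "(2::real) ^ 2 \<le> exp 1 ^ 2"
        using exp_ge_add_one_self[of "1::real"] by (intro power_mono) auto
      then have "4 \<le> exp (2::real)" by (simp flip: exp_of_nat_mult)
      then show "(\<Sum>z\<in>{- (2 ^ S)..2 ^ S}. exp (- real_of_int \<bar>z\<bar>)) \<le> exp 2"
        using sum_exp_neg_abs_le[of "2 ^ S"] by linarith
    qed (auto intro!: sum_nonneg)
    also have "\<dots> = exp (2 * real (card J))" by (simp add: exp_of_nat_mult[symmetric] mult.commute)
    also have "\<dots> \<le> exp (2 * real k * real N)" using card_J by simp
    finally show ?thesis by simp
  qed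
  have c_le: "c x \<le> real k / 4 * W" if x: "x \<in> Z \<times> {1, -1}" for x
  proof -
    obtain z e where xe: "x = (z, e)" "z \<in> Z" using x by auto
    have sq: "(2 ^ S)\<^sup>2 = W" by (simp add: W_def power_mult_distrib power2_eq_square flip: power_mult_distrib)
    have "c x \<le> (\<Sum>x\<in>J. W * (\<theta> z x)\<^sup>2)"
      unfolding xe c_def prod.case
    proof (rule sum_mono)
      fix y
      \<comment> \<open>Integrality turns the linear price into a square, which the norm constraint
        in \<open>Z\<close> controls.\<close>
      have "\<bar>z y\<bar> \<le> \<bar>z y\<bar> * \<bar>z y\<bar>"
      proof (cases "z y = 0")
        case False
        then have "1 \<le> \<bar>z y\<bar>" by linarith
        then have "\<bar>z y\<bar> * 1 \<le> \<bar>z y\<bar> * \<bar>z y\<bar>" by (rule mult_left_mono) simp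
        then show ?thesis by simp
      qed simp
      then have "real_of_int \<bar>z y\<bar> \<le> real_of_int (\<bar>z y\<bar> * \<bar>z y\<bar>)" by (simp only: of_int_le_iff)
      also have "\<dots> = (real_of_int (z y))\<^sup>2" by (simp add: power2_eq_square)
      also have "\<dots> = W * (\<theta> z y)\<^sup>2" by (simp add: \<theta>_def power_divide sq W_def[symmetric] W(1)[THEN less_imp_neq, symmetric])
      finally show "real_of_int \<bar>z y\<bar> \<le> W * (\<theta> z y)\<^sup>2" .
    qed
    also have "\<dots> = W * (\<Sum>j\<in>{1..k}. \<Sum>m\<in>{1..n j}. (\<theta> z (j, m))\<^sup>2)"
      by (simp add: sum_J sum_distrib_left)
    also have "\<dots> \<le> W * (\<Sum>j\<in>{1..k}. 1/4)"
      using xe W(1) by (intro mult_left_mono sum_mono) (auto simp: Z_def)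
    finally show ?thesis by (simp add: mult.commute)
  qed
  have t_le: "t \<le> (2 * real k + R) * W"
    unfolding t_def using W N0 R by (intro mult_left_mono) auto
  have sub: "{\<omega>. \<exists>z\<in>Z. \<bar>\<Sum>i\<in>light z. A i * (of_bool (\<omega> i) - p i) * T z i\<bar> > (64 + 3 * real k + R) * D}
     \<subseteq> {\<omega>. \<exists>x\<in>Z \<times> {1, -1}. F x \<omega> > 64 * W + c x + t}"
  proof safe
    fix \<omega> z
    let ?s = "\<Sum>i\<in>light z. A i * (of_bool (\<omega> i) - p i) * T z i"
    assume z: "z \<in> Z" and gt: "(64 + 3 * real k + R) * D < \<bar>?s\<bar>"
    define e :: real where "e = (if ?s \<ge> 0 then 1 else -1)"
    have mem: "(z, e) \<in> Z \<times> {1, -1}" using z by (auto simp: e_def)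
    have "F (z, e) \<omega> = \<mu> * (e * ?s)"
      by (simp add: F_def sum_distrib_left algebra_simps)
    also have "e * ?s = \<bar>?s\<bar>" by (auto simp: e_def)
    finally have "F (z, e) \<omega> > \<mu> * ((64 + 3 * real k + R) * D)" using gt \<mu> by simp
    also have "\<mu> * ((64 + 3 * real k + R) * D) = (64 + 3 * real k + R) * W"
      using D_pos by (simp add: \<mu>_def)
    finally have "F (z, e) \<omega> > (64 + 3 * real k + R) * W" .
    moreover have "64 * W + real k / 4 * W + (2 * real k + R) * W \<le> (64 + 3 * real k + R) * W"
      using W by (simp add: algebra_simps)
    ultimately have "F (z, e) \<omega> > 64 * W + c (z, e) + t" using c_le[OF mem] t_le by linarith
    then show "\<exists>x\<in>Z \<times> {1, -1}. F x \<omega> > 64 * W + c x + t" using mem by blast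
  qed
  have "measure_pmf.prob P {\<omega>. \<exists>z\<in>Z. \<bar>\<Sum>i\<in>light z. A i * (of_bool (\<omega> i) - p i) * T z i\<bar> > (64 + 3 * real k + R) * D}
      \<le> measure_pmf.prob P {\<omega>. \<exists>x\<in>Z \<times> {1, -1}. F x \<omega> > 64 * W + c x + t}"
    using sub by (intro measure_pmf.finite_measure_mono) auto
  also have "\<dots> \<le> 2 * exp (2 * real k * real N) * exp (- t)"
    by (rule chernoff_union_bound[OF _ finite_set_P mgf kraft]) (auto simp: finite_Z)
  also have "\<dots> = 2 * exp (- R * real N)" by (simp add: t_def exp_add[symmetric] algebra_simps)
  also have "\<dots> \<le> 2 * exp (- R * ln (real N))"
    using R N0 ln_le_minus_one[of "real N"] by (simp add: mult_left_mono)
  finally show ?thesis by (simp add: T_def)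
qed


section \<open>Degrees\<close>

text \<open>An element encodes a coordinate line: its direction \<open>j\<close> and the values of
  the other coordinates.\<close>

definition fibre_index :: "(nat \<times> (nat \<Rightarrow> nat)) set" where
  "fibre_index = Sigma {1..k} (\<lambda>j. Pi\<^sub>E ({1..k} - {j}) (\<lambda>j. {1..n j}))"

text \<open>The factor \<open>k\<close> is absorbed through
  \<open>k \<le> 2 ^ k \<le> N ^ k\<close>. A pure power of \<open>N\<close> is convenient because
  the union bound over lines then costs \<open>2 * k * ln N\<close>.\<close>

lemma card_fibre_index: "real (card fibre_index) \<le> real N ^ (2 * k)"
proof -
  have "card fibre_index = (\<Sum>j\<in>{1..k}. card (Pi\<^sub>E ({1..k} - {j}) (\<lambda>j. {1..n j})))"
    unfolding fibre_index_def by (subst card_SigmaI) (auto intro!: finite_PiE)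
  also have "\<dots> \<le> (\<Sum>j\<in>{1..k}. N ^ k)"
  proof (rule sum_mono)
    fix j assume "j \<in> {1..k}"
    have "card (Pi\<^sub>E ({1..k} - {j}) (\<lambda>j. {1..n j})) = (\<Prod>i\<in>{1..k} - {j}. n i)"
      by (subst card_PiE) auto
    also have "\<dots> \<le> (\<Prod>i\<in>{1..k} - {j}. N)" by (intro prod_mono) (auto intro: n_le)
    also have "\<dots> = N ^ card ({1..k} - {j})" by (rule prod_constant)
    also have "\<dots> \<le> N ^ k"
      using N_ge card_mono[of "{1..k}" "{1..k} - {j}"] by (intro power_increasing) auto
    finally show "card (Pi\<^sub>E ({1..k} - {j}) (\<lambda>j. {1..n j})) \<le> N ^ k" .
  qed
  also have "\<dots> = k * N ^ k" by simp
  also have "\<dots> \<le> N ^ k * N ^ k"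
  proof -
    have "k \<le> 2 ^ k" using less_exp[of k] by simp
    also have "\<dots> \<le> N ^ k" using N_ge by (intro power_mono) auto
    finally show ?thesis by (rule mult_right_mono) simp
  qed
  finally have "card fibre_index \<le> N ^ (2 * k)" by (simp add: power_add mult_2)
  then show ?thesis by (metis of_nat_le_iff of_nat_power)
qed

text \<open>Chernoff bound with parameter 1 and equal weights. The factor 2 bounds
  \<open>exp 1 - 1\<close>, and \<open>2 * k * ln N\<close> pays for the number of lines.\<close>

lemma degree_event:
  "measure_pmf.prob P {\<omega>. \<exists>(j, g)\<in>fibre_index.
      (\<Sum>m\<in>{1..n j}. of_bool (\<omega> (g(j := m)))) > 2 * (real N * q) + (2 * real k + R) * ln (real N)}
    \<le> exp (- R * ln (real N))"
proof -
  define F :: "nat \<times> (nat \<Rightarrow> nat) \<Rightarrow> ((nat \<Rightarrow> nat) \<Rightarrow> bool) \<Rightarrow> real"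
    where "F = (\<lambda>(j, g) \<omega>. \<Sum>m\<in>{1..n j}. of_bool (\<omega> (g(j := m))))"
  have N0: "real N > 0" using N_ge by simp
  have fin: "finite fibre_index" unfolding fibre_index_def by (auto intro!: finite_PiE)
  have mgf: "measure_pmf.expectation P (\<lambda>\<omega>. exp (F x \<omega>)) \<le> exp (2 * (real N * q))"
    if x: "x \<in> fibre_index" for x
  proof -
    obtain j g where jg: "x = (j, g)" "j \<in> {1..k}" "g \<in> Pi\<^sub>E ({1..k} - {j}) (\<lambda>j. {1..n j})"
      using x by (auto simp: fibre_index_def)
    define I' where "I' = (\<lambda>m. g(j := m)) ` {1..n j}"
    have inj: "inj_on (\<lambda>m. g(j := m)) {1..n j}" by (rule inj_onI) (metis fun_upd_same)
    have sub: "I' \<subseteq> I"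
    proof
      fix i assume "i \<in> I'"
      then obtain m where m: "i = g(j := m)" "m \<in> {1..n j}" by (auto simp: I'_def)
      have "insert j ({1..k} - {j}) = {1..k}" using jg(2) by auto
      moreover have "i \<in> Pi\<^sub>E (insert j ({1..k} - {j})) (\<lambda>j. {1..n j})"
        unfolding m(1) using m(2) jg(3) by (rule PiE_fun_upd)
      ultimately show "i \<in> I" by (simp add: I_def multi_index_def)
    qed
    have card: "card I' \<le> N" unfolding I'_def using n_le[OF jg(2)] card_image[OF inj] by simp
    have F: "F x \<omega> = (\<Sum>i\<in>I'. 1 * of_bool (\<omega> i))" for \<omega>
      unfolding jg(1) F_def prod.case I'_def by (subst sum.reindex[OF inj]) simp
    have "measure_pmf.expectation P (\<lambda>\<omega>. exp (F x \<omega>)) \<le> exp (\<Sum>i\<in>I'. p i * (exp 1 - 1))"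
      unfolding F by (rule mgf_sum[OF sub])
    also have "(\<Sum>i\<in>I'. p i * (exp 1 - 1)) \<le> (\<Sum>i\<in>I'. q * 2)"
      using p_bounds sub q_pos exp_le by (intro sum_mono mult_mono) (auto simp: I_def)
    also have "\<dots> \<le> real N * (q * 2)" using card q_pos by (simp add: mult_right_mono)
    finally show ?thesis by (simp add: algebra_simps)
  qed
  have "measure_pmf.prob P {\<omega>. \<exists>x\<in>fibre_index. F x \<omega> > 2 * (real N * q) + 0 + (2 * real k + R) * ln (real N)}
     \<le> real N ^ (2 * k) * exp (- ((2 * real k + R) * ln (real N)))"
    by (rule chernoff_union_bound[OF fin finite_set_P mgf]) (use card_fibre_index in auto)
  also have "real N ^ (2 * k) = exp (real (2 * k) * ln (real N))"
    unfolding exp_of_nat_mult using N0 by simp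
  also have "exp (real (2 * k) * ln (real N)) * exp (- ((2 * real k + R) * ln (real N))) = exp (- R * ln (real N))"
    by (simp add: exp_add[symmetric] algebra_simps)
  finally show ?thesis by (simp add: F_def case_prod_unfold)
qed

section \<open>Heavy multi-indices\<close>

definition T :: "(nat \<times> nat \<Rightarrow> nat) \<Rightarrow> (nat \<Rightarrow> nat) \<Rightarrow> real" where
  "T l i = (\<Prod>j\<in>{1..k}. (1/2) ^ l (j, i j))"

text \<open>The level of an entry is minus its binary logarithm, so the largest level
  \<open>s\<close> marks the smallest factor. The lower bound on \<open>T l i\<close> excludes tiny
  products; the upper bound excludes those that line degrees absorb.\<close>

definition level_set :: "nat \<Rightarrow> (nat \<times> nat \<Rightarrow> nat) \<Rightarrow> (nat \<Rightarrow> nat) set" where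
  "level_set s l = {i \<in> I. (\<forall>j\<in>{1..k}. l (j, i j) \<le> s) \<and> (\<exists>j\<in>{1..k}. l (j, i j) = s) \<and>
     \<tau> < T l i \<and> T l i \<le> D / 4 ^ s}"

text \<open>One plus the logarithm of the ratio \<open>4 ^ (S - s)\<close> between the two ends of
  the window for \<open>T l i\<close> in \<open>level_set\<close>.\<close>

definition L :: "nat \<Rightarrow> real" where
  "L s = 1 + real (S - s) * ln 4"

text \<open>A level above \<open>s\<close> is coded by \<open>Suc s\<close> in \<open>truncate\<close> below and is free of charge.\<close>

definition code_len :: "nat \<Rightarrow> (nat \<times> nat \<Rightarrow> nat) \<Rightarrow> real" where
  "code_len s l = (\<Sum>x\<in>J. if l x \<le> s then 2 * L s + real (s - l x) + 1 else 0)"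

lemma L_ge: "1 \<le> L s"
  by (simp add: L_def)

lemma exp_L: "exp (L s - 1) = 4 ^ (S - s)"
  by (simp add: L_def exp_of_nat_mult)

text \<open>The sum factors over \<open>J\<close>. One entry contributes at most
  \<open>1 + exp (- 2 * L s)\<close>, and there are at most \<open>k * 4 ^ S\<close> entries.
  Because of the 2 in front of \<open>L s\<close>, the exponent keeps a factor
  \<open>1 / 4 ^ (S - s)\<close>, which is summable over \<open>s\<close>.\<close>

lemma code_len_kraft:
  assumes "s \<le> S"
  shows "(\<Sum>l\<in>Pi\<^sub>E J (\<lambda>_. {0..Suc s}). exp (- code_len s l)) \<le> exp (real k * 4 ^ s / 4 ^ (S - s))"
proof -
  define w where "w v = exp (- (if v \<le> s then 2 * L s + real (s - v) + 1 else 0))" for v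
  have "(\<Sum>l\<in>Pi\<^sub>E J (\<lambda>_. {0..Suc s}). exp (- code_len s l)) = (\<Sum>l\<in>Pi\<^sub>E J (\<lambda>_. {0..Suc s}). \<Prod>x\<in>J. w (l x))"
    by (simp only: code_len_def w_def exp_sum[OF finite_J, symmetric] sum_negf[symmetric])
  also have "\<dots> = (\<Prod>x\<in>J. \<Sum>v\<in>{0..Suc s}. w v)"
    by (rule prod_sum_PiE[symmetric]) (auto simp: finite_J)
  also have "(\<Sum>v\<in>{0..Suc s}. w v) \<le> exp (exp (- 2 * L s))"
  proof -
    have "(\<Sum>v\<in>{0..s}. w v) = (\<Sum>d\<in>{0..s}. exp (- 2 * L s) * (exp (- 1) * exp (- real d)))"
      by (rule sum.reindex_bij_witness[of _ "\<lambda>d. s - d" "\<lambda>d. s - d"])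
        (auto simp: w_def exp_add[symmetric])
    also have "\<dots> \<le> (\<Sum>d\<in>{0..s}. exp (- 2 * L s) * (1/2 * (1/2) ^ d))"
      using exp_neg_nat_le[of 1] by (intro sum_mono mult_left_mono mult_mono exp_neg_nat_le) auto
    also have "\<dots> = exp (- 2 * L s) * (1/2 * (\<Sum>d\<in>{0..s}. (1/2) ^ d))"
      by (simp add: sum_distrib_left)
    also have "\<dots> \<le> exp (- 2 * L s) * (1/2 * 2)"
      using sum_powers_le[of "1/2" "{0..s}"] by (intro mult_left_mono) auto
    \<comment> \<open>The 1 is the weight of the free symbol \<open>Suc s\<close>.\<close>
    finally have "(\<Sum>v\<in>{0..Suc s}. w v) \<le> 1 + exp (- 2 * L s)" by (simp add: w_def)
    then show ?thesis using exp_ge_add_one_self[of "exp (- 2 * L s)"] by linarith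
  qed
  then have "(\<Prod>x\<in>J. \<Sum>v\<in>{0..Suc s}. w v) \<le> (\<Prod>x\<in>J. exp (exp (- 2 * L s)))"
    by (intro prod_mono conjI sum_nonneg) (simp_all only: w_def exp_ge_zero)
  also have "\<dots> = exp (real (card J) * exp (- 2 * L s))" by (simp add: exp_of_nat_mult)
  also have "\<dots> \<le> exp (real k * 4 ^ s / 4 ^ (S - s))"
  proof -
    have "exp (- 2 * L s) = exp (- 2) * exp (- (L s - 1)) * exp (- (L s - 1))"
      by (simp add: exp_add[symmetric])
    also have "\<dots> \<le> 1 * exp (- (L s - 1)) * exp (- (L s - 1))" by (intro mult_right_mono) auto
    also have "\<dots> = 1 / 4 ^ (S - s) / 4 ^ (S - s)" unfolding exp_minus exp_L by (simp add: field_simps)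
    finally have e: "exp (- 2 * L s) \<le> 1 / 4 ^ (S - s) / 4 ^ (S - s)" .
    have "real (card J) \<le> real k * 4 ^ S"
      by (rule order.trans[OF card_J mult_left_mono[OF N_le]]) simp
    then have "real (card J) * exp (- 2 * L s) \<le> real k * 4 ^ S * (1 / 4 ^ (S - s) / 4 ^ (S - s))"
      using e by (intro mult_mono) auto
    also have "(4::real) ^ S = 4 ^ s * 4 ^ (S - s)" using assms by (simp flip: power_add)
    finally show ?thesis by simp
  qed
  finally show ?thesis .
qed

text \<open>The parameter \<open>\<mu> = L s * 4 ^ s / D\<close> carries the window for
  \<open>T l i\<close> to the range between \<open>L s * exp (1 - L s)\<close> and
  \<open>L s\<close>, where \<open>exp_div_le_exp_div\<close> bounds \<open>exp y\<close> linearly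
  in \<open>y\<close>. The uncentred exponent is therefore at most a multiple of the sum of
  squares.\<close>

lemma level_event:
  assumes "s \<le> S"
  shows "measure_pmf.prob P {\<omega>. \<exists>l\<in>Pi\<^sub>E J (\<lambda>_. {0..Suc s}).
      (\<Sum>i\<in>level_set s l. T l i * of_bool (\<omega> i)) >
        64 * exp 1 * D * (\<Sum>i\<in>level_set s l. (T l i)\<^sup>2)
          + D / (L s * 4 ^ s) * (code_len s l + real k * 4 ^ s / 4 ^ (S - s) + R * ln (real N))}
    \<le> exp (- R * ln (real N))"
proof -
  define \<mu> where "\<mu> = L s * 4 ^ s / D"
  have L0: "L s > 0" using L_ge[of s] by linarith
  have \<mu>: "\<mu> > 0" "\<mu> * (D / (L s * 4 ^ s)) = 1" using L0 D_pos by (auto simp: \<mu>_def)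
  have pow: "(4::real) ^ S = 4 ^ s * 4 ^ (S - s)" using assms by (simp flip: power_add)
  define \<Psi> where "\<Psi> l = \<mu> * (64 * exp 1 * D * (\<Sum>i\<in>level_set s l. (T l i)\<^sup>2))" for l
  define F where "F l \<omega> = (\<Sum>i\<in>level_set s l. (\<mu> * T l i) * of_bool (\<omega> i))" for l and \<omega> :: "(nat \<Rightarrow> nat) \<Rightarrow> bool"
  \<comment> \<open>The first summand cancels the Kraft sum of
    \<open>code_len_kraft\<close>.\<close>
  define t where "t = real k * 4 ^ s / 4 ^ (S - s) + R * ln (real N)"
  have mgf: "measure_pmf.expectation P (\<lambda>\<omega>. exp (F l \<omega>)) \<le> exp (\<Psi> l)" for l
  proof -
    have "measure_pmf.expectation P (\<lambda>\<omega>. exp (F l \<omega>))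
        \<le> exp (\<Sum>i\<in>level_set s l. p i * (exp (\<mu> * T l i) - 1))"
      unfolding F_def by (rule mgf_sum) (auto simp: level_set_def)
    also have "(\<Sum>i\<in>level_set s l. p i * (exp (\<mu> * T l i) - 1))
        \<le> (\<Sum>i\<in>level_set s l. \<mu> * (64 * exp 1 * D * (T l i)\<^sup>2))"
    proof (rule sum_mono)
      fix i assume i: "i \<in> level_set s l"
      define y where "y = \<mu> * T l i"
      have Ti: "\<tau> < T l i" "T l i \<le> D / 4 ^ s" "i \<in> I" using i by (auto simp: level_set_def)
      have T0: "T l i > 0" using Ti tau_pos by linarith
      have "y \<le> \<mu> * (D / 4 ^ s)" unfolding y_def using Ti \<mu> by (intro mult_left_mono) auto
      also have "\<dots> = L s" using D_pos by (simp add: \<mu>_def)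
      finally have y1: "y \<le> L s" .
      have "exp (1 - L s) = 1 / 4 ^ (S - s)"
        using exp_L[of s] by (metis exp_minus inverse_eq_divide minus_diff_eq)
      then have "L s * exp (1 - L s) = \<mu> * \<tau>"
        using D_pos by (simp add: \<mu>_def \<tau>_def pow)
      also have "\<dots> \<le> y" unfolding y_def using Ti \<mu> by (intro mult_left_mono) auto
      finally have y2: "L s * exp (1 - L s) \<le> y" .
      have y0: "y > 0" using T0 \<mu> by (simp add: y_def)
      have "exp y \<le> y * exp (L s) / L s" by (rule exp_div_le_exp_div[OF L_ge y1 y2])
      also have "\<dots> = T l i * exp 1 * 4 ^ S / D"
      proof -
        have "exp (L s) = exp 1 * 4 ^ (S - s)" unfolding exp_L[symmetric] by (simp add: exp_add[symmetric])
        then show ?thesis using L0 by (simp add: y_def \<mu>_def pow)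
      qed
      finally have ey: "exp y \<le> T l i * exp 1 * 4 ^ S / D" .
      have "p i * (exp y - 1) \<le> q * (y * exp y)"
        using p_bounds[of i] Ti(3) exp_minus_one_le_mult_exp[of y] q_pos y0
        by (intro mult_mono) (auto simp: I_def)
      also have "\<dots> \<le> q * (y * (T l i * exp 1 * 4 ^ S / D))"
        using ey q_pos y0 by (intro mult_left_mono) auto
      also have "\<dots> = (q * 4 ^ S / D) * (y * T l i * exp 1)" by (simp add: algebra_simps)
      also have "\<dots> \<le> (64 * D) * (y * T l i * exp 1)"
        using q_scale_le y0 T0 by (intro mult_right_mono) auto
      also have "\<dots> = \<mu> * (64 * exp 1 * D * (T l i)\<^sup>2)" by (simp add: y_def power2_eq_square algebra_simps)
      finally show "p i * (exp (\<mu> * T l i) - 1) \<le> \<mu> * (64 * exp 1 * D * (T l i)\<^sup>2)" by (simp add: y_def)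
    qed
    finally show ?thesis by (simp add: \<Psi>_def sum_distrib_left)
  qed
  have "measure_pmf.prob P {\<omega>. \<exists>l\<in>Pi\<^sub>E J (\<lambda>_. {0..Suc s}). F l \<omega> > \<Psi> l + code_len s l + t}
      \<le> exp (real k * 4 ^ s / 4 ^ (S - s)) * exp (- t)"
    by (rule chernoff_union_bound[OF _ finite_set_P mgf code_len_kraft[OF assms]])
      (auto intro!: finite_PiE finite_J)
  also have "\<dots> = exp (- R * ln (real N))" by (simp add: t_def exp_add[symmetric])
  also have "(\<lambda>\<omega> l. F l \<omega> > \<Psi> l + code_len s l + t) = (\<lambda>\<omega> l.
      (\<Sum>i\<in>level_set s l. T l i * of_bool (\<omega> i)) >
        64 * exp 1 * D * (\<Sum>i\<in>level_set s l. (T l i)\<^sup>2)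
          + D / (L s * 4 ^ s) * (code_len s l + real k * 4 ^ s / 4 ^ (S - s) + R * ln (real N)))"
  proof (intro ext)
    fix \<omega> :: "(nat \<Rightarrow> nat) \<Rightarrow> bool" and l
    let ?Y = "\<Sum>i\<in>level_set s l. T l i * of_bool (\<omega> i)"
    let ?V = "64 * exp 1 * D * (\<Sum>i\<in>level_set s l. (T l i)\<^sup>2)"
    have "F l \<omega> = \<mu> * ?Y" by (simp add: F_def sum_distrib_left mult.assoc)
    moreover have "\<Psi> l + code_len s l + t = \<mu> * (?V + D / (L s * 4 ^ s) * (code_len s l + t))"
      unfolding \<Psi>_def distrib_left[of \<mu>] mult.assoc[symmetric, of \<mu> _ "code_len s l + t"] \<mu>(2)
      by simp
    ultimately show "(F l \<omega> > \<Psi> l + code_len s l + t) = (?Y > ?V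
          + D / (L s * 4 ^ s) * (code_len s l + real k * 4 ^ s / 4 ^ (S - s) + R * ln (real N)))"
      using \<mu>(1) by (simp add: t_def add.assoc)
  qed
  finally show ?thesis .
qed


section \<open>Deterministic estimate of the heavy sum\<close>

definition heavy :: "(nat \<times> nat \<Rightarrow> nat) \<Rightarrow> (nat \<Rightarrow> nat) set" where
  "heavy l = {i \<in> I. (\<forall>j\<in>{1..k}. l (j, i j) \<le> S) \<and> \<tau> < T l i}"

text \<open>Level \<open>Suc S\<close> stands for a zero entry.\<close>

definition dyadic :: "(nat \<times> nat \<Rightarrow> nat) \<Rightarrow> nat \<times> nat \<Rightarrow> real" where
  "dyadic l x = (if l x \<le> S then (1/2) ^ l x else 0)"

definition truncate :: "nat \<Rightarrow> (nat \<times> nat \<Rightarrow> nat) \<Rightarrow> nat \<times> nat \<Rightarrow> nat" where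
  "truncate s l = restrict (\<lambda>x. min (l x) (Suc s)) J"

lemma truncate_mem: "truncate s l \<in> Pi\<^sub>E J (\<lambda>_. {0..Suc s})"
  by (auto simp: truncate_def)

lemma truncate_eq_iff:
  assumes "x \<in> J"
  shows "truncate s l x \<le> s \<longleftrightarrow> l x \<le> s" "l x \<le> s \<Longrightarrow> truncate s l x = l x"
  using assms by (auto simp: truncate_def)

text \<open>Every multi-index of \<open>level_set s l\<close> meets only entries of level at most
  \<open>s\<close>. The union bound over the finitely many truncated codes thus covers all level
  functions \<open>l\<close>.\<close>

lemma level_set_truncate: "level_set s (truncate s l) = level_set s l"
  and T_truncate: "i \<in> level_set s l \<Longrightarrow> T (truncate s l) i = T l i"
proof -
  have T: "T (truncate s l) i = T l i" if "i \<in> I" "\<forall>j\<in>{1..k}. l (j, i j) \<le> s" for i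
    unfolding T_def by (intro prod.cong refl) (use that truncate_eq_iff index_mem_J in auto)
  then show "i \<in> level_set s l \<Longrightarrow> T (truncate s l) i = T l i" by (simp add: level_set_def)
  have "i \<in> level_set s (truncate s l) \<longleftrightarrow> i \<in> level_set s l" for i
  proof (cases "i \<in> I \<and> (\<forall>j\<in>{1..k}. l (j, i j) \<le> s)")
    case True
    then have "truncate s l (j, i j) = l (j, i j)" if "j \<in> {1..k}" for j
      using that truncate_eq_iff index_mem_J by simp
    then show ?thesis using True T[of i] by (simp add: level_set_def)
  next
    case False
    then show ?thesis using truncate_eq_iff(1) index_mem_J by (auto simp: level_set_def)
  qed
  then show "level_set s (truncate s l) = level_set s l" by blast
qed

lemma code_len_truncate: "code_len s (truncate s l) = code_len s l"
  unfolding code_len_def by (intro sum.cong refl) (auto simp: truncate_eq_iff)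

lemma heavy_subset_I: "heavy l \<subseteq> I"
  by (auto simp: heavy_def)

lemma T_eq_dyadic:
  assumes "i \<in> I" "\<forall>j\<in>{1..k}. l (j, i j) \<le> S"
  shows "T l i = (\<Prod>j\<in>{1..k}. dyadic l (j, i j))"
  unfolding T_def by (intro prod.cong refl) (use assms in \<open>auto simp: dyadic_def\<close>)

lemma dyadic_nonneg: "0 \<le> dyadic l x"
  by (simp add: dyadic_def)

lemma sum_prod_dyadic_sq_le_one:
  assumes "\<And>j. j \<in> {1..k} \<Longrightarrow> (\<Sum>m\<in>{1..n j}. (dyadic l (j, m))\<^sup>2) \<le> 1"
  shows "(\<Sum>i\<in>I. (\<Prod>j\<in>{1..k}. dyadic l (j, i j))\<^sup>2) \<le> 1"
  unfolding prod_power_distrib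
  by (rule sum_prod_le_one[where f = "\<lambda>j m. (dyadic l (j, m))\<^sup>2"]) (use assms in auto)

text \<open>The weight does not depend on the coordinate \<open>i j\<close>, so the sum in direction
  \<open>j\<close> is a line degree, at most \<open>C * D * D\<close>. The remaining sum of squares
  factors over the other directions and is at most 1.\<close>

lemma degree_part:
  fixes \<omega> :: "(nat \<Rightarrow> nat) \<Rightarrow> bool"
  assumes deg: "\<And>j g. (j, g) \<in> fibre_index \<Longrightarrow> (\<Sum>m\<in>{1..n j}. of_bool (\<omega> (g(j := m)))) \<le> C * (real N * q)"
    and l: "\<And>j. j \<in> {1..k} \<Longrightarrow> (\<Sum>m\<in>{1..n j}. (dyadic l (j, m))\<^sup>2) \<le> 1"
    and C: "0 \<le> C" and j: "j \<in> {1..k}"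
  shows "(\<Sum>i\<in>I. of_bool (\<omega> i) * ((\<Prod>j'\<in>{1..k} - {j}. (dyadic l (j', i j'))\<^sup>2) / D)) \<le> C * D"
proof -
  define G where "G = Pi\<^sub>E ({1..k} - {j}) (\<lambda>j. {1..n j})"
  define h where "h i = (\<Prod>j'\<in>{1..k} - {j}. (dyadic l (j', i j'))\<^sup>2)" for i
  have h_upd: "h (g(j := m)) = h g" for g m
    unfolding h_def by (intro prod.cong refl) auto
  have h0: "0 \<le> h g" for g by (auto simp: h_def intro!: prod_nonneg)
  have ins: "insert j ({1..k} - {j}) = {1..k}" using j by auto
  have "(\<Sum>i\<in>I. of_bool (\<omega> i) * (h i / D))
      = (\<Sum>g\<in>G. \<Sum>m\<in>{1..n j}. of_bool (\<omega> (g(j := m))) * (h (g(j := m)) / D))"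
    using sum_PiE_insert[of j "{1..k} - {j}" "\<lambda>i. of_bool (\<omega> i) * (h i / D)" "\<lambda>j. {1..n j}"]
    unfolding ins G_def I_def multi_index_def by simp
  also have "\<dots> = (\<Sum>g\<in>G. (h g / D) * (\<Sum>m\<in>{1..n j}. of_bool (\<omega> (g(j := m)))))"
    by (simp only: h_upd sum_distrib_left mult.commute)
  also have "\<dots> \<le> (\<Sum>g\<in>G. (h g / D) * (C * (real N * q)))"
    using h0 D_pos j by (intro sum_mono mult_left_mono deg) (auto simp: G_def fibre_index_def)
  also have "\<dots> = C * D * (\<Sum>g\<in>G. h g)"
    unfolding D_sq[symmetric] sum_distrib_left using D_pos by (intro sum.cong refl) simp
  also have "\<dots> \<le> C * D * 1"
  proof (rule mult_left_mono)
    have "(\<Sum>g\<in>G. h g) = (\<Prod>j'\<in>{1..k} - {j}. \<Sum>m\<in>{1..n j'}. (dyadic l (j', m))\<^sup>2)"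
      unfolding G_def h_def by (subst prod_sum_PiE) auto
    also have "\<dots> \<le> 1" by (intro prod_le_1 conjI sum_nonneg l) auto
    finally show "(\<Sum>g\<in>G. h g) \<le> 1" .
  qed (use C D_pos in simp)
  finally show ?thesis by (simp add: h_def)
qed

text \<open>If \<open>s\<close> is the largest level of \<open>i\<close>, attained in direction \<open>j\<close>, and \<open>U\<close> is the product of the
  other factors, then \<open>T l i = U / 2 ^ s\<close>, so \<open>T l i > D / 4 ^ s\<close> says that \<open>1 / 2 ^ s < U / D\<close>.\<close>

lemma heavy_cases:
  assumes "i \<in> heavy l"
  shows "(\<exists>s\<le>S. i \<in> level_set s l) \<or>
    (\<exists>j\<in>{1..k}. T l i \<le> (\<Prod>j'\<in>{1..k} - {j}. (dyadic l (j', i j'))\<^sup>2) / D)"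
proof -
  define s where "s = Max ((\<lambda>j. l (j, i j)) ` {1..k})"
  have i: "i \<in> I" "\<forall>j\<in>{1..k}. l (j, i j) \<le> S" "\<tau> < T l i" using assms by (auto simp: heavy_def)
  have "s \<in> (\<lambda>j. l (j, i j)) ` {1..k}" unfolding s_def using k_ge by (intro Max_in) auto
  then obtain j where j: "j \<in> {1..k}" "l (j, i j) = s" by auto
  have le_s: "\<forall>j\<in>{1..k}. l (j, i j) \<le> s" by (auto simp: s_def)
  have sS: "s \<le> S" using i(2) j by auto
  show ?thesis
  proof (cases "T l i \<le> D / 4 ^ s")
    case True
    then have "i \<in> level_set s l" using i j le_s by (auto simp: level_set_def)
    then show ?thesis using sS by blast
  next
    case False
    define U where "U = (\<Prod>j'\<in>{1..k} - {j}. dyadic l (j', i j'))"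
    have U0: "0 \<le> U" by (auto simp: U_def intro!: prod_nonneg dyadic_nonneg)
    have "T l i = dyadic l (j, i j) * U"
      unfolding T_eq_dyadic[OF i(1,2)] U_def using j by (subst prod.remove[of _ j]) auto
    then have T: "T l i = (1/2) ^ s * U" using j sS by (simp add: dyadic_def)
    have "D / 4 ^ s = (1/2) ^ s * ((1/2) ^ s * D)"
      by (simp add: power_one_over field_simps flip: power_mult_distrib)
    then have "(1/2) ^ s * ((1/2) ^ s * D) < (1/2) ^ s * U" using False T by simp
    then have "(1/2) ^ s * D < U" by (simp add: mult_less_cancel_left_pos)
    then have "(1/2) ^ s \<le> U / D" using D_pos by (simp add: pos_le_divide_eq)
    then have "T l i \<le> U / D * U" unfolding T using U0 by (rule mult_right_mono)
    then have "T l i \<le> U\<^sup>2 / D" by (simp add: power2_eq_square)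
    then show ?thesis using j(1) unfolding U_def prod_power_distrib by blast
  qed
qed

text \<open>The largest level of a multi-index is unique, so the level sets are disjoint and all
  their squares together are bounded by the squared norm of one product tensor.\<close>

lemma sum_level_sets_le:
  assumes "\<And>j. j \<in> {1..k} \<Longrightarrow> (\<Sum>m\<in>{1..n j}. (dyadic l (j, m))\<^sup>2) \<le> 1"
  shows "(\<Sum>s\<in>{0..S}. \<Sum>i\<in>level_set s l. (T l i)\<^sup>2) \<le> 1"
proof -
  have fin: "finite (level_set s l)" for s using finite_I by (simp add: level_set_def)
  have "s = s'" if "i \<in> level_set s l" "i \<in> level_set s' l" for i s s'
    using that by (force simp: level_set_def intro: antisym)
  then have disj: "\<forall>s\<in>{0..S}. \<forall>s'\<in>{0..S}. s \<noteq> s' \<longrightarrow> level_set s l \<inter> level_set s' l = {}" by blast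
  have "(\<Sum>s\<in>{0..S}. \<Sum>i\<in>level_set s l. (T l i)\<^sup>2) = (\<Sum>i\<in>(\<Union>s\<in>{0..S}. level_set s l). (T l i)\<^sup>2)"
    by (rule sum.UNION_disjoint[symmetric]) (use fin disj in auto)
  also have "\<dots> = (\<Sum>i\<in>(\<Union>s\<in>{0..S}. level_set s l). (\<Prod>j\<in>{1..k}. dyadic l (j, i j))\<^sup>2)"
  proof (rule sum.cong[OF refl])
    fix i assume "i \<in> (\<Union>s\<in>{0..S}. level_set s l)"
    then have "i \<in> I" "\<forall>j\<in>{1..k}. l (j, i j) \<le> S" by (auto simp: level_set_def intro: order_trans)
    then show "(T l i)\<^sup>2 = (\<Prod>j\<in>{1..k}. dyadic l (j, i j))\<^sup>2" using T_eq_dyadic by simp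
  qed
  also have "\<dots> \<le> (\<Sum>i\<in>I. (\<Prod>j\<in>{1..k}. dyadic l (j, i j))\<^sup>2)"
    by (rule sum_mono2[OF finite_I]) (auto simp: level_set_def)
  also have "\<dots> \<le> 1" by (rule sum_prod_dyadic_sq_le_one) (rule assms)
  finally show ?thesis .
qed

text \<open>Exchange the sums. As \<open>L s \<ge> 1\<close>, an entry of level \<open>v\<close>
  costs at most \<open>D * (3 + (s - v)) / 4 ^ s\<close> for each \<open>s \<ge> v\<close>. This
  series decays geometrically and is at most \<open>6 * D\<close> times the square of the
  entry.\<close>

lemma sum_code_len_le:
  assumes "\<And>j. j \<in> {1..k} \<Longrightarrow> (\<Sum>m\<in>{1..n j}. (dyadic l (j, m))\<^sup>2) \<le> 1"
  shows "(\<Sum>s\<in>{0..S}. D / (L s * 4 ^ s) * code_len s l) \<le> 6 * real k * D"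
proof -
  have inner: "(\<Sum>s\<in>{0..S}. if v \<le> s then (3 + real (s - v)) / 4 ^ s else 0)
      \<le> 6 * (if v \<le> S then (1/2) ^ v else 0)\<^sup>2" for v
  proof (cases "v \<le> S")
    case True
    have "(\<Sum>s\<in>{0..S}. if v \<le> s then (3 + real (s - v)) / 4 ^ s else 0)
        = (\<Sum>s\<in>{v..S}. (3 + real (s - v)) / 4 ^ s)"
      by (rule sum.mono_neutral_cong_right) auto
    also have "\<dots> = (\<Sum>d\<in>{0..S - v}. (3 + real d) / 4 ^ (v + d))"
      by (rule sum.reindex_bij_witness[of _ "\<lambda>d. v + d" "\<lambda>s. s - v"]) (use True in auto)
    also have "\<dots> \<le> (\<Sum>d\<in>{0..S - v}. 3 / 4 ^ v * (1/2) ^ d)"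
    proof (rule sum_mono)
      fix d
      have "(3 + real d) / 4 ^ (v + d) \<le> 3 * 2 ^ d / 4 ^ (v + d)"
        by (intro divide_right_mono three_plus_le) simp
      also have "3 * 2 ^ d / (4::real) ^ (v + d) = 3 / 4 ^ v * (2 ^ d / 4 ^ d)"
        by (simp add: power_add)
      also have "(2::real) ^ d / 4 ^ d = (1/2) ^ d" by (simp flip: power_divide)
      finally show "(3 + real d) / 4 ^ (v + d) \<le> 3 / 4 ^ v * (1/2) ^ d" .
    qed
    also have "\<dots> \<le> 3 / 4 ^ v * 2"
      unfolding sum_distrib_left[symmetric] by (intro mult_left_mono sum_halves_le) auto
    also have "\<dots> = 6 * ((1/2) ^ v)\<^sup>2"
      by (simp add: power_one_over power2_eq_square flip: power_mult_distrib)
    finally show ?thesis using True by simp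
  next
    case False
    then have "(\<Sum>s\<in>{0..S}. if v \<le> s then (3 + real (s - v)) / 4 ^ s else 0) = 0"
      by (intro sum.neutral) auto
    then show ?thesis using False by simp
  qed
  have "(\<Sum>s\<in>{0..S}. D / (L s * 4 ^ s) * code_len s l)
      \<le> (\<Sum>s\<in>{0..S}. \<Sum>x\<in>J. D * (if l x \<le> s then (3 + real (s - l x)) / 4 ^ s else 0))"
    unfolding code_len_def sum_distrib_left
  proof (intro sum_mono)
    fix s x
    have L1: "1 \<le> L s" by (rule L_ge)
    have "2 * L s + real (s - l x) + 1 \<le> L s * (3 + real (s - l x))"
      using L1 mult_right_mono[OF L1, of "real (s - l x)"] by (simp add: distrib_left)
    then have "D / (L s * 4 ^ s) * (2 * L s + real (s - l x) + 1)
        \<le> D / (L s * 4 ^ s) * (L s * (3 + real (s - l x)))"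
      using D_pos L1 by (intro mult_left_mono) auto
    also have "\<dots> = D * ((3 + real (s - l x)) / 4 ^ s)" using L1 by simp
    finally show "D / (L s * 4 ^ s) * (if l x \<le> s then 2 * L s + real (s - l x) + 1 else 0)
        \<le> D * (if l x \<le> s then (3 + real (s - l x)) / 4 ^ s else 0)"
      by (cases "l x \<le> s") (simp_all only: if_True if_False mult_zero_right order_refl)
  qed
  also have "\<dots> = D * (\<Sum>x\<in>J. \<Sum>s\<in>{0..S}. if l x \<le> s then (3 + real (s - l x)) / 4 ^ s else 0)"
    by (subst sum.swap) (simp add: sum_distrib_left)
  also have "\<dots> \<le> D * (\<Sum>x\<in>J. 6 * (dyadic l x)\<^sup>2)"
    using D_pos unfolding dyadic_def by (intro mult_left_mono sum_mono inner) auto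
  also have "\<dots> = D * 6 * (\<Sum>j\<in>{1..k}. \<Sum>m\<in>{1..n j}. (dyadic l (j, m))\<^sup>2)"
    by (simp add: sum_J sum_distrib_left mult.assoc)
  also have "\<dots> \<le> D * 6 * (\<Sum>j\<in>{1..k}. 1)"
    using D_pos assms by (intro mult_left_mono sum_mono) auto
  finally show ?thesis by (simp add: algebra_simps)
qed

text \<open>The powers \<open>4 ^ s\<close> cancel, and what remains decays geometrically as
  \<open>s\<close> moves down from \<open>S\<close>.\<close>

lemma sum_kraft_terms_le:
  "(\<Sum>s\<in>{0..S}. D / (L s * 4 ^ s) * (real k * 4 ^ s / 4 ^ (S - s))) \<le> 2 * real k * D"
proof -
  have "(\<Sum>s\<in>{0..S}. D / (L s * 4 ^ s) * (real k * 4 ^ s / 4 ^ (S - s))) \<le> (\<Sum>s\<in>{0..S}. real k * D * (1/2) ^ (S - s))"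
  proof (rule sum_mono)
    fix s
    have L1: "1 \<le> L s" by (rule L_ge)
    have "D / (L s * 4 ^ s) * (real k * 4 ^ s / 4 ^ (S - s)) = (real k * D) * (1 / (L s * 4 ^ (S - s)))"
      using L1 by (simp add: field_simps)
    also have "\<dots> \<le> (real k * D) * (1 / (1 * 2 ^ (S - s)))"
      using L1 D_pos by (intro mult_left_mono divide_left_mono mult_mono power_mono mult_pos_pos) auto
    finally show "D / (L s * 4 ^ s) * (real k * 4 ^ s / 4 ^ (S - s)) \<le> real k * D * (1/2) ^ (S - s)"
      by (simp add: power_one_over)
  qed
  also have "\<dots> = real k * D * (\<Sum>d\<in>{0..S}. (1/2) ^ d)"
    unfolding sum_distrib_left by (rule sum.reindex_bij_witness[of _ "\<lambda>d. S - d" "\<lambda>s. S - s"]) auto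
  also have "\<dots> \<le> real k * D * 2"
    using D_pos by (intro mult_left_mono sum_halves_le) auto
  finally show ?thesis by (simp add: algebra_simps)
qed

text \<open>From \<open>N \<le> 4 ^ S\<close>, \<open>ln N\<close> is at most
  \<open>L s * (1 + s * ln 4)\<close>. Division by \<open>L s\<close> removes the logarithm of
  \<open>N / 4 ^ s\<close>, and \<open>4 ^ s\<close> outweighs the factor linear in
  \<open>s\<close>, so no logarithm of \<open>N\<close> is lost.\<close>

lemma sum_log_terms_le:
  assumes "0 \<le> R"
  shows "(\<Sum>s\<in>{0..S}. D / (L s * 4 ^ s) * (R * ln (real N))) \<le> 6 * R * D"
proof -
  have N0: "real N > 0" using N_ge by simp
  have "(\<Sum>s\<in>{0..S}. D / (L s * 4 ^ s) * (R * ln (real N))) \<le> (\<Sum>s\<in>{0..S}. R * D * 3 * (1/2) ^ s)"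
  proof (rule sum_mono)
    fix s assume s: "s \<in> {0..S}"
    have L1: "1 \<le> L s" by (rule L_ge)
    have ln4: "0 \<le> ln (4::real)" "ln (4::real) \<le> 2"
      using ln_realpow[of 2 2] ln_le_minus_one[of "2::real"] by auto
    have "ln (real N) \<le> ln (4 ^ S)" by (rule iffD2[OF ln_le_cancel_iff N_le]) (use N0 in auto)
    also have "\<dots> = real (S - s) * ln 4 + real s * ln 4"
      using s by (simp add: ln_realpow of_nat_diff algebra_simps)
    also have "\<dots> \<le> L s + L s * (real s * ln 4)"
      using mult_right_mono[OF L1, of "real s * ln 4"] ln4 by (simp add: L_def)
    also have "\<dots> = L s * (1 + real s * ln 4)" by (simp add: algebra_simps)
    also have "\<dots> \<le> L s * (3 * 2 ^ s)"
    proof (rule mult_left_mono)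
      have "real s * ln 4 \<le> real s * 2" using ln4 by (intro mult_left_mono) auto
      moreover have "1 + real s * 2 \<le> 3 * 2 ^ s"
      proof (induction s)
        case (Suc s)
        have "(1::real) \<le> 2 ^ s" by (rule one_le_power) simp
        with Suc have "3 + real s * 2 \<le> 6 * 2 ^ s" by linarith
        then show ?case by simp
      qed simp
      ultimately show "1 + real s * ln 4 \<le> 3 * 2 ^ s" by linarith
    qed (use L1 in simp)
    finally have "ln (real N) \<le> L s * (3 * 2 ^ s)" .
    then have "D / (L s * 4 ^ s) * (R * ln (real N)) \<le> D / (L s * 4 ^ s) * (R * (L s * (3 * 2 ^ s)))"
      using D_pos L1 assms by (intro mult_left_mono) auto
    also have "\<dots> = R * D * 3 * (2 ^ s / 4 ^ s)" using L1 by simp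
    also have "(2::real) ^ s / 4 ^ s = (1/2) ^ s" by (simp flip: power_divide)
    finally show "D / (L s * 4 ^ s) * (R * ln (real N)) \<le> R * D * 3 * (1/2) ^ s" .
  qed
  also have "\<dots> \<le> R * D * 3 * 2"
    unfolding sum_distrib_left[symmetric] using assms D_pos by (intro mult_left_mono sum_halves_le) auto
  finally show ?thesis by (simp add: algebra_simps)
qed

text \<open>By \<open>heavy_cases\<close> each heavy term is charged to a level set or to a
  direction. All charges are nonnegative, so it is safe to sum them over every \<open>s\<close> and
  every \<open>j\<close>.\<close>

lemma heavy_bound:
  fixes \<omega> :: "(nat \<Rightarrow> nat) \<Rightarrow> bool"
  assumes deg: "\<And>j g. (j, g) \<in> fibre_index \<Longrightarrow> (\<Sum>m\<in>{1..n j}. of_bool (\<omega> (g(j := m)))) \<le> C * (real N * q)"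
    and lev: "\<And>s l. s \<le> S \<Longrightarrow> l \<in> Pi\<^sub>E J (\<lambda>_. {0..Suc s}) \<Longrightarrow>
      (\<Sum>i\<in>level_set s l. T l i * of_bool (\<omega> i)) \<le>
        64 * exp 1 * D * (\<Sum>i\<in>level_set s l. (T l i)\<^sup>2)
          + D / (L s * 4 ^ s) * (code_len s l + real k * 4 ^ s / 4 ^ (S - s) + R * ln (real N))"
    and l: "\<And>j. j \<in> {1..k} \<Longrightarrow> (\<Sum>m\<in>{1..n j}. (dyadic l (j, m))\<^sup>2) \<le> 1"
    and C: "0 \<le> C" and R: "0 \<le> R"
  shows "(\<Sum>i\<in>heavy l. T l i * of_bool (\<omega> i)) \<le> (real k * C + 64 * exp 1 + 8 * real k + 6 * R) * D"
proof -
  have T0: "0 \<le> T l i" for i by (auto simp: T_def intro!: prod_nonneg)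
  define h where "h j i = of_bool (\<omega> i) * ((\<Prod>j'\<in>{1..k} - {j}. (dyadic l (j', i j'))\<^sup>2) / D)" for j i
  have h0: "0 \<le> h j i" for j i using D_pos by (auto simp: h_def intro!: mult_nonneg_nonneg divide_nonneg_pos prod_nonneg)
  define f where "f i = T l i * of_bool (\<omega> i)" for i
  have f0: "0 \<le> f i" for i by (simp add: f_def T0)
  have "(\<Sum>i\<in>heavy l. f i) \<le> (\<Sum>i\<in>heavy l. (\<Sum>s\<in>{0..S}. if i \<in> level_set s l then f i else 0) + (\<Sum>j\<in>{1..k}. h j i))"
  proof (rule sum_mono)
    fix i assume i: "i \<in> heavy l"
    have n1: "0 \<le> (\<Sum>s\<in>{0..S}. if i \<in> level_set s l then f i else 0)" by (intro sum_nonneg) (simp add: f0)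
    have n2: "0 \<le> (\<Sum>j\<in>{1..k}. h j i)" by (intro sum_nonneg h0)
    from heavy_cases[OF i] show "f i \<le> (\<Sum>s\<in>{0..S}. if i \<in> level_set s l then f i else 0) + (\<Sum>j\<in>{1..k}. h j i)"
    proof
      assume "\<exists>s\<le>S. i \<in> level_set s l"
      then obtain s where s: "s \<in> {0..S}" "i \<in> level_set s l" by auto
      have "f i = (if i \<in> level_set s l then f i else 0)" using s by simp
      also have "\<dots> \<le> (\<Sum>s\<in>{0..S}. if i \<in> level_set s l then f i else 0)"
        by (rule member_le_sum[of s "{0..S}" "\<lambda>s. if i \<in> level_set s l then f i else 0"]) (use s f0 in auto)
      finally show ?thesis using n2 by linarith
    next
      assume "\<exists>j\<in>{1..k}. T l i \<le> (\<Prod>j'\<in>{1..k} - {j}. (dyadic l (j', i j'))\<^sup>2) / D"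
      then obtain j where j: "j \<in> {1..k}" "T l i \<le> (\<Prod>j'\<in>{1..k} - {j}. (dyadic l (j', i j'))\<^sup>2) / D" by auto
      have "f i \<le> h j i" using j(2) by (simp add: f_def h_def)
      also have "\<dots> \<le> (\<Sum>j\<in>{1..k}. h j i)" by (rule member_le_sum) (use j h0 in auto)
      finally show ?thesis using n1 by linarith
    qed
  qed
  also have "\<dots> = (\<Sum>s\<in>{0..S}. \<Sum>i\<in>heavy l. if i \<in> level_set s l then f i else 0) + (\<Sum>j\<in>{1..k}. \<Sum>i\<in>heavy l. h j i)"
    by (simp only: sum.distrib sum.swap[of _ _ "heavy l"])
  also have "(\<Sum>j\<in>{1..k}. \<Sum>i\<in>heavy l. h j i) \<le> (\<Sum>j\<in>{1..k}. C * D)"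
  proof (rule sum_mono)
    fix j assume j: "j \<in> {1..k}"
    have "(\<Sum>i\<in>heavy l. h j i) \<le> (\<Sum>i\<in>I. h j i)"
      by (rule sum_mono2[OF finite_I heavy_subset_I]) (rule h0)
    also have "\<dots> \<le> C * D" unfolding h_def by (rule degree_part[OF deg l C j])
    finally show "(\<Sum>i\<in>heavy l. h j i) \<le> C * D" .
  qed
  also have "(\<Sum>s\<in>{0..S}. \<Sum>i\<in>heavy l. if i \<in> level_set s l then f i else 0)
    \<le> (\<Sum>s\<in>{0..S}. 64 * exp 1 * D * (\<Sum>i\<in>level_set s l. (T l i)\<^sup>2)
          + D / (L s * 4 ^ s) * (code_len s l + real k * 4 ^ s / 4 ^ (S - s) + R * ln (real N)))"
  proof (rule sum_mono)
    fix s assume s: "s \<in> {0..S}"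
    have "(\<Sum>i\<in>heavy l. if i \<in> level_set s l then f i else 0) \<le> (\<Sum>i\<in>I. if i \<in> level_set s l then f i else 0)"
      by (rule sum_mono2[OF finite_I heavy_subset_I]) (simp add: f0)
    also have "\<dots> = (\<Sum>i\<in>level_set s l. f i)"
      by (rule sum.mono_neutral_cong_right) (auto simp: finite_I level_set_def)
    \<comment> \<open>The hypothesis on level sets speaks of codes with values up to
      \<open>Suc s\<close> only.\<close>
    also have "\<dots> = (\<Sum>i\<in>level_set s (truncate s l). T (truncate s l) i * of_bool (\<omega> i))"
      unfolding level_set_truncate f_def by (intro sum.cong refl) (simp only: T_truncate)
    also have "\<dots> \<le> 64 * exp 1 * D * (\<Sum>i\<in>level_set s (truncate s l). (T (truncate s l) i)\<^sup>2)
          + D / (L s * 4 ^ s) * (code_len s (truncate s l) + real k * 4 ^ s / 4 ^ (S - s) + R * ln (real N))"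
      by (rule lev[OF _ truncate_mem]) (use s in auto)
    also have "(\<Sum>i\<in>level_set s (truncate s l). (T (truncate s l) i)\<^sup>2) = (\<Sum>i\<in>level_set s l. (T l i)\<^sup>2)"
      unfolding level_set_truncate by (intro sum.cong refl) (simp only: T_truncate)
    finally show "(\<Sum>i\<in>heavy l. if i \<in> level_set s l then f i else 0)
       \<le> 64 * exp 1 * D * (\<Sum>i\<in>level_set s l. (T l i)\<^sup>2)
          + D / (L s * 4 ^ s) * (code_len s l + real k * 4 ^ s / 4 ^ (S - s) + R * ln (real N))"
      by (simp only: code_len_truncate)
  qed
  also have "(\<Sum>s\<in>{0..S}. 64 * exp 1 * D * (\<Sum>i\<in>level_set s l. (T l i)\<^sup>2)
          + D / (L s * 4 ^ s) * (code_len s l + real k * 4 ^ s / 4 ^ (S - s) + R * ln (real N)))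
     = 64 * exp 1 * D * (\<Sum>s\<in>{0..S}. \<Sum>i\<in>level_set s l. (T l i)\<^sup>2)
       + ((\<Sum>s\<in>{0..S}. D / (L s * 4 ^ s) * code_len s l)
       + (\<Sum>s\<in>{0..S}. D / (L s * 4 ^ s) * (real k * 4 ^ s / 4 ^ (S - s)))
       + (\<Sum>s\<in>{0..S}. D / (L s * 4 ^ s) * (R * ln (real N))))"
    by (simp only: sum.distrib sum_distrib_left distrib_left)
  also have "\<dots> \<le> 64 * exp 1 * D * 1 + (6 * real k * D + 2 * real k * D + 6 * R * D)"
    using D_pos by (intro add_mono mult_left_mono sum_level_sets_le sum_code_len_le sum_kraft_terms_le sum_log_terms_le l R) auto
  finally show ?thesis by (simp add: f_def algebra_simps)
qed


section \<open>Rounding and assembly\<close>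

definition unit_tuples :: "(nat \<Rightarrow> nat \<Rightarrow> real) set" where
  "unit_tuples = {x. \<forall>j\<in>{1..k}. L2_set (x j) {1..n j} = 1}"

text \<open>After scaling by 1/4, each coordinate is moved to a neighbouring lattice value by
  \<open>multiaffine_le_vertex\<close>, which does not decrease the form in modulus. Only the
  scaling costs, a factor \<open>4 ^ k\<close>.\<close>

lemma lattice_rounding:
  fixes B :: "(nat \<Rightarrow> nat) \<Rightarrow> real"
  assumes x: "x \<in> unit_tuples"
  obtains z where "z \<in> Z"
    "\<bar>\<Sum>i\<in>I. B i * (\<Prod>j\<in>{1..k}. x j (i j))\<bar> \<le> 4 ^ k * \<bar>\<Sum>i\<in>I. B i * (\<Prod>j\<in>{1..k}. \<theta> z (j, i j))\<bar>"
proof -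
  define f where "f u = (\<Sum>i\<in>I. B i * (\<Prod>j\<in>{1..k}. u (j, i j)))" for u :: "nat \<times> nat \<Rightarrow> real"
  define u where "u = (\<lambda>(j, m). x j m / 4)"
  define lo where "lo y = real_of_int \<lfloor>u y * 2 ^ S\<rfloor> / 2 ^ S" for y
  define hi where "hi y = real_of_int \<lceil>u y * 2 ^ S\<rceil> / 2 ^ S" for y
  \<comment> \<open>A coordinate in direction \<open>j0\<close> enters a monomial only through its
    factor number \<open>j0\<close>, hence at most to the first power.\<close>
  have affine: "\<exists>a b. \<forall>t. f (u(y := t)) = a + b * t" if yJ: "y \<in> J" for u y
  proof -
    obtain j0 m0 where y: "y = (j0, m0)" "j0 \<in> {1..k}" using yJ by (auto simp: J_def)
    define r where "r i = (\<Prod>j\<in>{1..k} - {j0}. u (j, i j))" for i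
    define a where "a = (\<Sum>i\<in>I. if i j0 = m0 then 0 else B i * (u (j0, i j0) * r i))"
    define b where "b = (\<Sum>i\<in>I. if i j0 = m0 then B i * r i else 0)"
    have "f (u(y := t)) = a + b * t" for t
    proof -
      have "(\<Prod>j\<in>{1..k}. (u(y := t)) (j, i j)) = (u(y := t)) (j0, i j0) * r i" for i
        unfolding r_def using y
        by (subst prod.remove[of _ j0]) (auto intro!: arg_cong2[of _ _ _ _ "(*)"] prod.cong)
      then have "f (u(y := t)) = (\<Sum>i\<in>I. (if i j0 = m0 then 0 else B i * (u (j0, i j0) * r i))
          + (if i j0 = m0 then B i * r i else 0) * t)"
        unfolding f_def by (intro sum.cong refl) (auto simp: y)
      then show ?thesis by (simp only: sum.distrib a_def b_def sum_distrib_right)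
    qed
    then show ?thesis by blast
  qed
  have lohi: "lo y \<le> u y \<and> u y \<le> hi y" for y
    by (simp add: lo_def hi_def pos_divide_le_eq pos_le_divide_eq)
  obtain v where v: "\<forall>y\<in>J. v y = lo y \<or> v y = hi y" "\<bar>f u\<bar> \<le> \<bar>f v\<bar>"
    using multiaffine_le_vertex[OF finite_J affine, where lo = lo and u = u and hi = hi] lohi by blast
  define z where "z = restrict (\<lambda>y. if v y = lo y then \<lfloor>u y * 2 ^ S\<rfloor> else \<lceil>u y * 2 ^ S\<rceil>) J"
  have \<theta>v: "\<theta> z y = v y" if "y \<in> J" for y
    using that v(1) by (auto simp: \<theta>_def z_def lo_def hi_def)
  have close: "\<bar>v y - u y\<bar> \<le> 1 / 2 ^ S" if "y \<in> J" for y
  proof -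
    have "\<bar>v y * 2 ^ S - u y * 2 ^ S\<bar> \<le> 1"
    proof (cases "v y = lo y")
      case True
      then have "v y * 2 ^ S = real_of_int \<lfloor>u y * 2 ^ S\<rfloor>" by (simp add: lo_def)
      then show ?thesis by linarith
    next
      case False
      then have "v y * 2 ^ S = real_of_int \<lceil>u y * 2 ^ S\<rceil>" using v(1) that by (auto simp: hi_def)
      then show ?thesis by linarith
    qed
    moreover have "\<bar>v y * 2 ^ S - u y * 2 ^ S\<bar> = \<bar>v y - u y\<bar> * 2 ^ S"
      by (simp add: abs_mult flip: left_diff_distrib)
    ultimately show ?thesis by (simp add: pos_le_divide_eq)
  qed
  have norm: "(\<Sum>m\<in>{1..n j}. (\<theta> z (j, m))\<^sup>2) \<le> 1/4" if j: "j \<in> {1..k}" for j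
  proof -
    have "L2_set (x j) {1..n j} = 1" using x j by (simp add: unit_tuples_def)
    then have x1: "(\<Sum>m\<in>{1..n j}. (x j m)\<^sup>2) = 1" by (simp add: L2_set_def)
    \<comment> \<open>The square of a sum is at most twice the sum of the squares. The scaled vector
      contributes 2/16, and the rounding error at most \<open>2 * n j / 4 ^ S\<close>, again at most
      1/8.\<close>
    have "(\<Sum>m\<in>{1..n j}. (\<theta> z (j, m))\<^sup>2) \<le> (\<Sum>m\<in>{1..n j}. (x j m)\<^sup>2 / 8 + 2 * (1 / 4 ^ S))"
    proof (rule sum_mono)
      fix m assume m: "m \<in> {1..n j}"
      then have J: "(j, m) \<in> J" using j by (auto simp: J_def)
      define d where "d = v (j, m) - u (j, m)"
      have "\<bar>d\<bar>\<^sup>2 \<le> (1 / 2 ^ S)\<^sup>2" unfolding d_def by (rule power_mono[OF close[OF J]]) simp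
      also have "(1 / 2 ^ S)\<^sup>2 = 1 / (4::real) ^ S"
        by (simp add: power_one_over power2_eq_square flip: power_mult_distrib)
      finally have d2: "d\<^sup>2 \<le> 1 / 4 ^ S" by simp
      have "(u (j, m) + d)\<^sup>2 \<le> 2 * (u (j, m))\<^sup>2 + 2 * d\<^sup>2"
        using zero_le_power2[of "u (j, m) - d"] by (simp add: power2_eq_square algebra_simps)
      moreover have "(u (j, m))\<^sup>2 = (x j m)\<^sup>2 / 16" by (simp add: u_def power_divide)
      moreover have "\<theta> z (j, m) = u (j, m) + d" using \<theta>v[OF J] by (simp add: d_def)
      ultimately show "(\<theta> z (j, m))\<^sup>2 \<le> (x j m)\<^sup>2 / 8 + 2 * (1 / 4 ^ S)" using d2 by simp
    qed
    also have "\<dots> = 1 / 8 + 2 * real (n j) / 4 ^ S"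
      unfolding sum.distrib sum_divide_distrib[symmetric] x1 by simp
    also have "\<dots> \<le> 1 / 8 + 1 / 8"
    proof -
      have "16 * real (n j) \<le> 4 ^ S" using n_le[OF j] S_lower by (smt (verit) of_nat_mono)
      then have "16 * real (n j) / 4 ^ S \<le> 1" by (subst divide_le_eq_1_pos) auto
      moreover have "2 * real (n j) / 4 ^ S = (16 * real (n j) / 4 ^ S) / 8" by simp
      ultimately show ?thesis by linarith
    qed
    finally show ?thesis by simp
  qed
  have range: "z y \<in> {- (2 ^ S)..2 ^ S}" if y: "y \<in> J" for y
  proof -
    obtain j m where jm: "y = (j, m)" "j \<in> {1..k}" "m \<in> {1..n j}" using y by (auto simp: J_def)
    have "(\<theta> z (j, m))\<^sup>2 \<le> (\<Sum>m\<in>{1..n j}. (\<theta> z (j, m))\<^sup>2)"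
      by (rule member_le_sum[of m "{1..n j}" "\<lambda>m. (\<theta> z (j, m))\<^sup>2"]) (use jm in auto)
    then have "(\<theta> z y)\<^sup>2 \<le> 1" using norm[OF jm(2)] jm(1) by simp
    then have "\<bar>\<theta> z y\<bar> \<le> 1" by (simp add: abs_square_le_1)
    then have "\<bar>real_of_int (z y)\<bar> \<le> 2 ^ S" by (simp add: \<theta>_def)
    then have "real_of_int \<bar>z y\<bar> \<le> real_of_int (2 ^ S)" by simp
    then have "\<bar>z y\<bar> \<le> 2 ^ S" by (simp only: of_int_le_iff)
    then show ?thesis by auto
  qed
  have "z \<in> Z" unfolding Z_def using range norm by (auto simp: z_def)
  moreover have "(\<Sum>i\<in>I. B i * (\<Prod>j\<in>{1..k}. x j (i j))) = 4 ^ k * f u"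
    by (simp add: f_def u_def prod_dividef sum_distrib_left)
  moreover have "f v = (\<Sum>i\<in>I. B i * (\<Prod>j\<in>{1..k}. \<theta> z (j, i j)))"
    unfolding f_def by (intro sum.cong arg_cong2[of _ _ _ _ "(*)"] prod.cong refl) (simp add: \<theta>v index_mem_J)
  ultimately show ?thesis using v(2) that[of z] by (simp add: abs_mult)
qed

text \<open>Rounding up at most doubles the entries, so squared norms grow from 1/4 to at most 1.
  Zero entries receive level \<open>Suc S\<close>; a product that is not light has no such
  factor.\<close>

lemma dyadic_cover:
  assumes "z \<in> Z"
  obtains l where "\<And>j. j \<in> {1..k} \<Longrightarrow> (\<Sum>m\<in>{1..n j}. (dyadic l (j, m))\<^sup>2) \<le> 1"
    and "I - light z \<subseteq> heavy l"
    and "\<And>i. i \<in> I - light z \<Longrightarrow> \<bar>\<Prod>j\<in>{1..k}. \<theta> z (j, i j)\<bar> \<le> T l i"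
proof -
  have "\<forall>x\<in>J. \<exists>v. if z x = 0 then v = Suc S
      else v \<le> S \<and> \<bar>\<theta> z x\<bar> \<le> (1/2) ^ v \<and> (1/2) ^ v \<le> 2 * \<bar>\<theta> z x\<bar>"
  proof
    fix x assume x: "x \<in> J"
    then have "z x \<in> {- (2 ^ S)..2 ^ S}" using assms unfolding Z_def by (auto dest: PiE_mem)
    then have "\<bar>z x\<bar> \<le> 2 ^ S" by auto
    then show "\<exists>v. if z x = 0 then v = Suc S
      else v \<le> S \<and> \<bar>\<theta> z x\<bar> \<le> (1/2) ^ v \<and> (1/2) ^ v \<le> 2 * \<bar>\<theta> z x\<bar>"
      using dyadic_round_up[of "z x" S] by (auto simp: \<theta>_def)
  qed
  then obtain l where l: "\<And>x. x \<in> J \<Longrightarrow> if z x = 0 then l x = Suc S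
      else l x \<le> S \<and> \<bar>\<theta> z x\<bar> \<le> (1/2) ^ l x \<and> (1/2) ^ l x \<le> 2 * \<bar>\<theta> z x\<bar>"
    by (metis (no_types, lifting) bchoice)
  have 1: "(\<Sum>m\<in>{1..n j}. (dyadic l (j, m))\<^sup>2) \<le> 1" if j: "j \<in> {1..k}" for j
  proof -
    have "(\<Sum>m\<in>{1..n j}. (dyadic l (j, m))\<^sup>2) \<le> (\<Sum>m\<in>{1..n j}. 4 * (\<theta> z (j, m))\<^sup>2)"
    proof (rule sum_mono)
      fix m assume "m \<in> {1..n j}"
      then have x: "(j, m) \<in> J" using j by (auto simp: J_def)
      have "dyadic l (j, m) \<le> 2 * \<bar>\<theta> z (j, m)\<bar>"
        using l[OF x] by (auto simp: dyadic_def split: if_splits)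
      then have "(dyadic l (j, m))\<^sup>2 \<le> (2 * \<bar>\<theta> z (j, m)\<bar>)\<^sup>2"
        using dyadic_nonneg by (intro power_mono)
      then show "(dyadic l (j, m))\<^sup>2 \<le> 4 * (\<theta> z (j, m))\<^sup>2" by (simp add: power_mult_distrib)
    qed
    also have "\<dots> = 4 * (\<Sum>m\<in>{1..n j}. (\<theta> z (j, m))\<^sup>2)" by (simp add: sum_distrib_left)
    also have "\<dots> \<le> 4 * (1/4)" using assms j by (intro mult_left_mono) (auto simp: Z_def)
    finally show ?thesis by simp
  qed
  have 2: "i \<in> heavy l \<and> \<bar>\<Prod>j\<in>{1..k}. \<theta> z (j, i j)\<bar> \<le> T l i" if i: "i \<in> I - light z" for i
  proof -
    have gt: "\<tau> < \<bar>\<Prod>j\<in>{1..k}. \<theta> z (j, i j)\<bar>" using i by (auto simp: light_def)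
    then have nz: "(\<Prod>j\<in>{1..k}. \<theta> z (j, i j)) \<noteq> 0" using tau_pos by (metis abs_zero less_asym)
    have lj: "l (j, i j) \<le> S \<and> \<bar>\<theta> z (j, i j)\<bar> \<le> (1/2) ^ l (j, i j)" if j: "j \<in> {1..k}" for j
    proof -
      have "\<theta> z (j, i j) \<noteq> 0" using nz j by auto
      then have "z (j, i j) \<noteq> 0" by (auto simp: \<theta>_def)
      then show ?thesis using l[OF index_mem_J[of i j]] i j by simp
    qed
    have le: "\<bar>\<Prod>j\<in>{1..k}. \<theta> z (j, i j)\<bar> \<le> T l i"
      unfolding T_def abs_prod by (intro prod_mono) (use lj in auto)
    then show ?thesis using gt lj i by (auto simp: heavy_def)
  qed
  show ?thesis using that[of l] 1 2 by blast
qed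

text \<open>On the good event the light part is controlled by hypothesis. The rest is bounded in
  absolute value, separately for the random part, through \<open>heavy_bound\<close>, and for the
  mean.\<close>

lemma multilinear_form_bound:
  fixes A :: "(nat \<Rightarrow> nat) \<Rightarrow> real"
  assumes A: "\<And>i. i \<in> I \<Longrightarrow> \<bar>A i\<bar> \<le> 1"
    and light: "\<And>z. z \<in> Z \<Longrightarrow>
      \<bar>\<Sum>i\<in>light z. A i * (of_bool (\<omega> i) - p i) * (\<Prod>j\<in>{1..k}. \<theta> z (j, i j))\<bar> \<le> C1 * D"
    and deg: "\<And>j g. (j, g) \<in> fibre_index \<Longrightarrow> (\<Sum>m\<in>{1..n j}. of_bool (\<omega> (g(j := m)))) \<le> C * (real N * q)"
    and lev: "\<And>s l. s \<le> S \<Longrightarrow> l \<in> Pi\<^sub>E J (\<lambda>_. {0..Suc s}) \<Longrightarrow>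
      (\<Sum>i\<in>level_set s l. T l i * of_bool (\<omega> i)) \<le>
        64 * exp 1 * D * (\<Sum>i\<in>level_set s l. (T l i)\<^sup>2)
          + D / (L s * 4 ^ s) * (code_len s l + real k * 4 ^ s / 4 ^ (S - s) + R * ln (real N))"
    and C: "0 \<le> C" and R: "0 \<le> R"
    and x: "x \<in> unit_tuples"
  shows "\<bar>\<Sum>i\<in>I. A i * (of_bool (\<omega> i) - p i) * (\<Prod>j\<in>{1..k}. x j (i j))\<bar>
    \<le> 4 ^ k * (C1 + 64 + real k * C + 64 * exp 1 + 8 * real k + 6 * R) * D"
proof -
  define B where "B i = A i * (of_bool (\<omega> i) - p i)" for i
  obtain z where z: "z \<in> Z"
    and xz: "\<bar>\<Sum>i\<in>I. B i * (\<Prod>j\<in>{1..k}. x j (i j))\<bar> \<le> 4 ^ k * \<bar>\<Sum>i\<in>I. B i * (\<Prod>j\<in>{1..k}. \<theta> z (j, i j))\<bar>"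
    using lattice_rounding[OF x] by blast
  define t where "t i = (\<Prod>j\<in>{1..k}. \<theta> z (j, i j))" for i
  obtain l where l1: "\<And>j. j \<in> {1..k} \<Longrightarrow> (\<Sum>m\<in>{1..n j}. (dyadic l (j, m))\<^sup>2) \<le> 1"
    and l2: "I - light z \<subseteq> heavy l" and l3: "\<And>i. i \<in> I - light z \<Longrightarrow> \<bar>t i\<bar> \<le> T l i"
    using dyadic_cover[OF z] unfolding t_def by blast
  have sub: "light z \<subseteq> I" by (auto simp: light_def)
  have T0: "0 \<le> T l i" for i by (auto simp: T_def intro!: prod_nonneg)
  have mean: "(\<Sum>i\<in>I - light z. p i * \<bar>t i\<bar>) \<le> 64 * D"
  proof -
    \<comment> \<open>A product larger than \<open>\<tau>\<close> is at most its square divided by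
      \<open>\<tau>\<close>, and the squares sum to at most 1.\<close>
    have "(\<Sum>i\<in>I - light z. p i * \<bar>t i\<bar>) \<le> (\<Sum>i\<in>I - light z. q / \<tau> * (t i)\<^sup>2)"
    proof (rule sum_mono)
      fix i assume i: "i \<in> I - light z"
      have "\<tau> \<le> \<bar>t i\<bar>" using i by (auto simp: light_def t_def)
      then have "\<tau> * \<bar>t i\<bar> \<le> \<bar>t i\<bar> * \<bar>t i\<bar>" by (rule mult_right_mono) simp
      then have "\<bar>t i\<bar> \<le> (t i)\<^sup>2 / \<tau>" using tau_pos by (simp add: pos_le_divide_eq power2_eq_square mult.commute)
      then have "p i * \<bar>t i\<bar> \<le> q * ((t i)\<^sup>2 / \<tau>)"
        using p_bounds[of i] i q_pos by (intro mult_mono) (auto simp: I_def)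
      then show "p i * \<bar>t i\<bar> \<le> q / \<tau> * (t i)\<^sup>2" by simp
    qed
    also have "\<dots> \<le> q / \<tau> * 1"
      unfolding sum_distrib_left[symmetric] t_def using q_pos tau_pos
      by (intro mult_left_mono sum_prod_theta_sq_le_one z) auto
    also have "\<dots> \<le> 64 * D" using q_scale_le by (simp add: \<tau>_def)
    finally show ?thesis .
  qed
  have rand: "(\<Sum>i\<in>I - light z. of_bool (\<omega> i) * \<bar>t i\<bar>) \<le> (real k * C + 64 * exp 1 + 8 * real k + 6 * R) * D"
  proof -
    have "(\<Sum>i\<in>I - light z. of_bool (\<omega> i) * \<bar>t i\<bar>) \<le> (\<Sum>i\<in>I - light z. T l i * of_bool (\<omega> i))"
      using l3 by (intro sum_mono) auto
    also have "\<dots> \<le> (\<Sum>i\<in>heavy l. T l i * of_bool (\<omega> i))"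
      using finite_subset[OF heavy_subset_I finite_I] l2 T0 by (intro sum_mono2) auto
    also have "\<dots> \<le> (real k * C + 64 * exp 1 + 8 * real k + 6 * R) * D"
      by (rule heavy_bound[OF deg lev l1 C R])
    finally show ?thesis .
  qed
  have "\<bar>\<Sum>i\<in>I - light z. B i * t i\<bar> \<le> (\<Sum>i\<in>I - light z. of_bool (\<omega> i) * \<bar>t i\<bar> + p i * \<bar>t i\<bar>)"
  proof (rule order.trans[OF sum_abs sum_mono])
    fix i assume i: "i \<in> I - light z"
    have "\<bar>of_bool (\<omega> i) - p i\<bar> \<le> of_bool (\<omega> i) + p i" using p_bounds[of i] i by (auto simp: I_def)
    then have "\<bar>B i\<bar> \<le> 1 * (of_bool (\<omega> i) + p i)"
      unfolding B_def abs_mult using A[of i] i by (intro mult_mono) auto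
    then have "\<bar>B i\<bar> * \<bar>t i\<bar> \<le> (of_bool (\<omega> i) + p i) * \<bar>t i\<bar>" by (intro mult_right_mono) auto
    then show "\<bar>B i * t i\<bar> \<le> of_bool (\<omega> i) * \<bar>t i\<bar> + p i * \<bar>t i\<bar>" by (simp only: abs_mult distrib_right)
  qed
  also have "\<dots> \<le> (real k * C + 64 * exp 1 + 8 * real k + 6 * R) * D + 64 * D"
    unfolding sum.distrib using rand mean by linarith
  finally have nl: "\<bar>\<Sum>i\<in>I - light z. B i * t i\<bar> \<le> (real k * C + 64 * exp 1 + 8 * real k + 6 * R) * D + 64 * D" .
  have "(\<Sum>i\<in>I. B i * t i) = (\<Sum>i\<in>I - light z. B i * t i) + (\<Sum>i\<in>light z. B i * t i)"
    by (rule sum.subset_diff[OF sub finite_I])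
  moreover have "\<bar>\<Sum>i\<in>light z. B i * t i\<bar> \<le> C1 * D" using light[OF z] by (simp add: B_def t_def)
  ultimately have "\<bar>\<Sum>i\<in>I. B i * t i\<bar> \<le> (C1 + 64 + real k * C + 64 * exp 1 + 8 * real k + 6 * R) * D"
    using nl by (simp add: algebra_simps)
  then have "4 ^ k * \<bar>\<Sum>i\<in>I. B i * t i\<bar> \<le> 4 ^ k * ((C1 + 64 + real k * C + 64 * exp 1 + 8 * real k + 6 * R) * D)"
    by (intro mult_left_mono) auto
  from order.trans[OF xz[folded t_def] this] show ?thesis by (simp only: B_def mult.assoc)
qed

text \<open>The failure events are the light one, the degree one and one for each of the
  \<open>S + 1\<close> levels. Their total probability is at most
  \<open>(S + 4) * N powr (- R)\<close>, and the loss \<open>S + 4\<close> is covered by a fixed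
  power of \<open>N\<close>.\<close>

lemma multilinear_form_tail:
  fixes A :: "(nat \<Rightarrow> nat) \<Rightarrow> real"
  assumes A: "\<And>i. i \<in> I \<Longrightarrow> \<bar>A i\<bar> \<le> 1" and R: "0 \<le> R" and c: "0 < c" "c * ln (real N) \<le> real N * q"
  shows "measure_pmf.prob P {\<omega>. \<exists>x\<in>unit_tuples.
      \<bar>\<Sum>i\<in>I. A i * (of_bool (\<omega> i) - p i) * (\<Prod>j\<in>{1..k}. x j (i j))\<bar>
        > 4 ^ k * (128 + 11 * real k + 7 * R + real k * (2 + (2 * real k + R) / c) + 64 * exp 1) * D}
    \<le> real N powr (8 - R)"
proof -
  \<comment> \<open>Density gives \<open>ln N \<le> N * q / c\<close>, so the logarithm in the
    degree bound becomes a multiple of \<open>N * q\<close>.\<close>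
  define C where "C = 2 + (2 * real k + R) / c"
  define e where "e = exp (- R * ln (real N))"
  define E1 where "E1 = {\<omega>. \<exists>z\<in>Z.
      \<bar>\<Sum>i\<in>light z. A i * (of_bool (\<omega> i) - p i) * (\<Prod>j\<in>{1..k}. \<theta> z (j, i j))\<bar> > (64 + 3 * real k + R) * D}"
  define E2 where "E2 = {\<omega>. \<exists>(j, g)\<in>fibre_index.
      (\<Sum>m\<in>{1..n j}. of_bool (\<omega> (g(j := m)))) > 2 * (real N * q) + (2 * real k + R) * ln (real N)}"
  define E3 where "E3 s = {\<omega>. \<exists>l\<in>Pi\<^sub>E J (\<lambda>_. {0..Suc s}).
      (\<Sum>i\<in>level_set s l. T l i * of_bool (\<omega> i)) >
        64 * exp 1 * D * (\<Sum>i\<in>level_set s l. (T l i)\<^sup>2)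
          + D / (L s * 4 ^ s) * (code_len s l + real k * 4 ^ s / 4 ^ (S - s) + R * ln (real N))}" for s
  have N0: "real N > 0" "real N \<ge> 2" using N_ge by auto
  have C0: "0 \<le> C" using c R by (simp add: C_def)
  have deg_le: "2 * (real N * q) + (2 * real k + R) * ln (real N) \<le> C * (real N * q)"
  proof -
    have "ln (real N) \<le> real N * q / c" using c by (simp add: pos_le_divide_eq mult.commute)
    then have "(2 * real k + R) * ln (real N) \<le> (2 * real k + R) * (real N * q / c)"
      using R by (intro mult_left_mono) auto
    then show ?thesis by (simp add: C_def distrib_right)
  qed
  have const: "4 ^ k * (128 + 11 * real k + 7 * R + real k * C + 64 * exp 1) * D
      = 4 ^ k * ((64 + 3 * real k + R) + 64 + real k * C + 64 * exp 1 + 8 * real k + 6 * R) * D"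
    by (simp add: algebra_simps)
  have sub: "{\<omega>. \<exists>x\<in>unit_tuples.
      \<bar>\<Sum>i\<in>I. A i * (of_bool (\<omega> i) - p i) * (\<Prod>j\<in>{1..k}. x j (i j))\<bar>
        > 4 ^ k * (128 + 11 * real k + 7 * R + real k * C + 64 * exp 1) * D}
    \<subseteq> E1 \<union> (E2 \<union> (\<Union>s\<in>{0..S}. E3 s))"
  proof (rule subsetI, rule ccontr)
    fix \<omega>
    assume in_bad: "\<omega> \<in> {\<omega>. \<exists>x\<in>unit_tuples.
      \<bar>\<Sum>i\<in>I. A i * (of_bool (\<omega> i) - p i) * (\<Prod>j\<in>{1..k}. x j (i j))\<bar>
        > 4 ^ k * (128 + 11 * real k + 7 * R + real k * C + 64 * exp 1) * D}"
      and notin: "\<omega> \<notin> E1 \<union> (E2 \<union> (\<Union>s\<in>{0..S}. E3 s))"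
    from in_bad obtain x where x: "x \<in> unit_tuples"
      "\<bar>\<Sum>i\<in>I. A i * (of_bool (\<omega> i) - p i) * (\<Prod>j\<in>{1..k}. x j (i j))\<bar>
        > 4 ^ k * ((64 + 3 * real k + R) + 64 + real k * C + 64 * exp 1 + 8 * real k + 6 * R) * D"
      unfolding const by blast
    have "\<bar>\<Sum>i\<in>I. A i * (of_bool (\<omega> i) - p i) * (\<Prod>j\<in>{1..k}. x j (i j))\<bar>
        \<le> 4 ^ k * ((64 + 3 * real k + R) + 64 + real k * C + 64 * exp 1 + 8 * real k + 6 * R) * D"
    proof (rule multilinear_form_bound[OF A _ _ _ C0 R x(1)])
      show "\<bar>\<Sum>i\<in>light z. A i * (of_bool (\<omega> i) - p i) * (\<Prod>j\<in>{1..k}. \<theta> z (j, i j))\<bar>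
          \<le> (64 + 3 * real k + R) * D" if "z \<in> Z" for z
        using notin that unfolding E1_def by (simp add: not_less)
      show "(\<Sum>m\<in>{1..n j}. of_bool (\<omega> (g(j := m)))) \<le> C * (real N * q)" if "(j, g) \<in> fibre_index" for j g
      proof -
        have "\<omega> \<notin> E2" using notin by blast
        then have "\<not> (\<Sum>m\<in>{1..n j}. of_bool (\<omega> (g(j := m)))) > 2 * (real N * q) + (2 * real k + R) * ln (real N)"
          using that unfolding E2_def by blast
        then show ?thesis using deg_le by linarith
      qed
      show "(\<Sum>i\<in>level_set s l. T l i * of_bool (\<omega> i)) \<le>
        64 * exp 1 * D * (\<Sum>i\<in>level_set s l. (T l i)\<^sup>2)
          + D / (L s * 4 ^ s) * (code_len s l + real k * 4 ^ s / 4 ^ (S - s) + R * ln (real N))"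
        if "s \<le> S" "l \<in> Pi\<^sub>E J (\<lambda>_. {0..Suc s})" for s l
      proof -
        have "\<omega> \<notin> E3 s" using notin that(1) by auto
        then show ?thesis using that(2) unfolding E3_def mem_Collect_eq by (meson not_less)
      qed
    qed
    then show False using x(2) by linarith
  qed
  have "measure_pmf.prob P (\<Union>s\<in>{0..S}. E3 s) \<le> (\<Sum>s\<in>{0..S}. measure_pmf.prob P (E3 s))"
    by (rule measure_pmf.finite_measure_subadditive_finite) auto
  also have "\<dots> \<le> (\<Sum>s\<in>{0..S}. e)"
    unfolding E3_def e_def by (intro sum_mono level_event) auto
  finally have p3: "measure_pmf.prob P (\<Union>s\<in>{0..S}. E3 s) \<le> (real S + 1) * e" by (simp add: add.commute)
  have p1: "measure_pmf.prob P E1 \<le> 2 * e" unfolding E1_def e_def by (rule light_event[OF A R])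
  have p2: "measure_pmf.prob P E2 \<le> e" unfolding E2_def e_def by (rule degree_event)
  have "measure_pmf.prob P (E1 \<union> (E2 \<union> (\<Union>s\<in>{0..S}. E3 s))) \<le> (real S + 4) * e"
    using measure_Un_le[of E1 "measure_pmf P" "E2 \<union> (\<Union>s\<in>{0..S}. E3 s)"]
      measure_Un_le[of E2 "measure_pmf P" "\<Union>s\<in>{0..S}. E3 s"] p1 p2 p3
    by (simp add: algebra_simps)
  \<comment> \<open>Here \<open>S + 4 \<le> 4 ^ S + 3 \<le> 128 * N\<close>, and
    \<open>128 = 2 ^ 7\<close> is at most \<open>N ^ 7\<close>.\<close>
  also have "\<dots> \<le> real N powr 8 * e"
  proof (rule mult_right_mono)
    have "real S + 1 \<le> 4 ^ S"
    proof (induction S)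
      case (Suc S)
      then show ?case unfolding power_Suc of_nat_Suc by linarith
    qed simp
    then have "real S + 4 \<le> 128 * real N" using S_upper N0 by linarith
    also have "\<dots> \<le> real N ^ 7 * real N"
    proof (rule mult_right_mono)
      have "(2::real) ^ 7 \<le> real N ^ 7" using N0 by (intro power_mono) auto
      then show "128 \<le> real N ^ 7" by simp
    qed simp
    also have "\<dots> = real N powr 8" using N0 by (simp add: powr_numeral flip: power_Suc2)
    finally show "real S + 4 \<le> real N powr 8" .
  qed (simp add: e_def)
  also have "\<dots> = real N powr (8 - R)" using N0 by (simp add: e_def powr_def left_diff_distrib exp_diff exp_minus field_simps)
  finally have "measure_pmf.prob P (E1 \<union> (E2 \<union> (\<Union>s\<in>{0..S}. E3 s))) \<le> real N powr (8 - R)" .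
  then show ?thesis
    using measure_pmf.finite_measure_mono[OF sub, of P] unfolding C_def by simp
qed

end

theorem corollary2p2:
  fixes k :: nat and c r :: real
  assumes "k \<ge> 2" and "c > 0" and "r > 0"
  shows "\<exists>C :: real. \<forall>(N :: nat) (n :: nat \<Rightarrow> nat) (A :: (nat \<Rightarrow> nat) \<Rightarrow> real)
           (p :: (nat \<Rightarrow> nat) \<Rightarrow> real).
     N \<ge> 2 \<longrightarrow>
     (\<forall>j\<in>{1..k}. 1 \<le> n j \<and> n j \<le> N) \<longrightarrow>
     (\<forall>i\<in>multi_index k n. 0 \<le> p i \<and> p i \<le> 1) \<longrightarrow>
     (let pstar = Max (p ` multi_index k n);
          P = bernoulli_tensor k n p
      in real N * pstar \<ge> c * ln (real N) \<longrightarrow>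
         measure_pmf.prob P
           {\<omega>. spectral_norm k n (\<lambda>i. A i * (of_bool (\<omega> i) - tensor_mean P i))
                > C * max_norm k n A * sqrt (real N * pstar)}
         \<le> real N powr (- r))"
proof -
  \<comment> \<open>The extra 8 offsets the factor \<open>N powr 8\<close> lost to the number of
    events.\<close>
  define R where "R = r + 8"
  define C where "C = 4 ^ k * (128 + 11 * real k + 7 * R + real k * (2 + (2 * real k + R) / c) + 64 * exp 1)"
  have R0: "0 \<le> R" using assms by (simp add: R_def)
  show ?thesis
  proof (rule exI[of _ C], intro allI impI, unfold Let_def, intro impI)
    fix N :: nat and n :: "nat \<Rightarrow> nat" and A p :: "(nat \<Rightarrow> nat) \<Rightarrow> real"
    assume N: "N \<ge> 2" and n: "\<forall>j\<in>{1..k}. 1 \<le> n j \<and> n j \<le> N"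
      and p: "\<forall>i\<in>multi_index k n. 0 \<le> p i \<and> p i \<le> 1"
      and dense: "c * ln (real N) \<le> real N * Max (p ` multi_index k n)"
    define q where "q = Max (p ` multi_index k n)"
    define a where "a = max_norm k n A"
    \<comment> \<open>As \<open>ln N\<close> is positive, the density hypothesis rules out that all
      probabilities vanish.\<close>
    have "0 < c * ln (real N)" using assms N by simp
    then have "0 < real N * q" using dense by (simp add: q_def)
    then have q: "0 < q" using N by (simp add: zero_less_mult_iff)
    have pq: "p i \<le> q" if "i \<in> multi_index k n" for i
      unfolding q_def using that by (intro Max_ge) (auto simp: finite_multi_index)
    obtain S where S: "16 * real N \<le> 4 ^ S" "4 ^ S \<le> 64 * real N" using dyadic_scale_exists[of N] N by auto
    interpret sparse_tensor k N S n p q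
      by unfold_locales (use assms N n p pq q S in auto)
    have Aa: "\<bar>A i\<bar> \<le> a" if "i \<in> I" for i
      unfolding a_def max_norm_def using that by (intro Max_ge) (auto simp: I_def finite_multi_index)
    have nonempty: "I \<noteq> {}" using n by (auto simp: I_def multi_index_def PiE_eq_empty_iff)
    then have a0: "0 \<le> a" using Aa by (meson abs_ge_zero all_not_in_conv order_trans)
    \<comment> \<open>If \<open>a = 0\<close>, division yields \<open>A' i = 0\<close>, and
      \<open>A i = a * A' i\<close> still holds on \<open>I\<close> because \<open>A\<close>
      vanishes there.\<close>
    define A' where "A' i = A i / a" for i
    have A': "\<bar>A' i\<bar> \<le> 1" "A i = a * A' i" if "i \<in> I" for i
      using Aa[OF that] a0 by (auto simp: A'_def divide_le_eq)
    \<comment> \<open>A pointwise bound passes to the supremum only over a nonempty set; the first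
      basis vectors are available because \<open>n j \<ge> 1\<close>.\<close>
    have unit: "unit_tuples \<noteq> {}"
    proof -
      have "L2_set (\<lambda>m. if m = 1 then 1 else 0) {1..n j} = (1::real)" if "j \<in> {1..k}" for j
        using n that by (simp add: L2_set_def if_distrib[of "\<lambda>x. x\<^sup>2"] cong: if_cong)
      then have "(\<lambda>j m. if m = 1 then 1 else 0) \<in> unit_tuples" by (simp add: unit_tuples_def)
      then show ?thesis by blast
    qed
    have "{\<omega>. spectral_norm k n (\<lambda>i. A i * (of_bool (\<omega> i) - tensor_mean P i)) > C * a * D}
      \<subseteq> {\<omega>. \<exists>x\<in>unit_tuples. \<bar>\<Sum>i\<in>I. A' i * (of_bool (\<omega> i) - p i) * (\<Prod>j\<in>{1..k}. x j (i j))\<bar> > C * D}"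
    proof (rule subsetI, rule ccontr)
      fix \<omega>
      assume gt: "\<omega> \<in> {\<omega>. spectral_norm k n (\<lambda>i. A i * (of_bool (\<omega> i) - tensor_mean P i)) > C * a * D}"
        and "\<omega> \<notin> {\<omega>. \<exists>x\<in>unit_tuples. \<bar>\<Sum>i\<in>I. A' i * (of_bool (\<omega> i) - p i) * (\<Prod>j\<in>{1..k}. x j (i j))\<bar> > C * D}"
      then have le: "\<bar>\<Sum>i\<in>I. A' i * (of_bool (\<omega> i) - p i) * (\<Prod>j\<in>{1..k}. x j (i j))\<bar> \<le> C * D"
        if "x \<in> unit_tuples" for x using that by (simp add: not_less)
      have "spectral_norm k n (\<lambda>i. A i * (of_bool (\<omega> i) - tensor_mean P i)) \<le> C * a * D"
        unfolding spectral_norm_def unit_tuples_def[symmetric] I_def[symmetric]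
      proof (rule cSUP_least[OF unit])
        fix x assume x: "x \<in> unit_tuples"
        have "(\<Sum>i\<in>I. A i * (of_bool (\<omega> i) - tensor_mean P i) * (\<Prod>j\<in>{1..k}. x j (i j)))
            = a * (\<Sum>i\<in>I. A' i * (of_bool (\<omega> i) - p i) * (\<Prod>j\<in>{1..k}. x j (i j)))"
          unfolding sum_distrib_left by (intro sum.cong refl) (simp add: A'(2) tensor_mean_eq)
        then have "\<bar>\<Sum>i\<in>I. A i * (of_bool (\<omega> i) - tensor_mean P i) * (\<Prod>j\<in>{1..k}. x j (i j))\<bar>
            = a * \<bar>\<Sum>i\<in>I. A' i * (of_bool (\<omega> i) - p i) * (\<Prod>j\<in>{1..k}. x j (i j))\<bar>"
          using a0 by (simp add: abs_mult)
        also have "\<dots> \<le> a * (C * D)" using le[OF x] a0 by (rule mult_left_mono)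
        finally show "\<bar>\<Sum>i\<in>I. A i * (of_bool (\<omega> i) - tensor_mean P i) * (\<Prod>j\<in>{1..k}. x j (i j))\<bar> \<le> C * a * D"
          by (simp add: algebra_simps)
      qed
      then show False using gt by simp
    qed
    then have "measure_pmf.prob P {\<omega>. spectral_norm k n (\<lambda>i. A i * (of_bool (\<omega> i) - tensor_mean P i)) > C * a * D}
      \<le> measure_pmf.prob P {\<omega>. \<exists>x\<in>unit_tuples.
          \<bar>\<Sum>i\<in>I. A' i * (of_bool (\<omega> i) - p i) * (\<Prod>j\<in>{1..k}. x j (i j))\<bar> > C * D}"
      by (intro measure_pmf.finite_measure_mono) auto
    also have "\<dots> \<le> real N powr (8 - R)"
      unfolding C_def by (rule multilinear_form_tail[OF A'(1) R0]) (use assms dense in \<open>auto simp: q_def\<close>)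
    finally show "measure_pmf.prob (bernoulli_tensor k n p)
           {\<omega>. spectral_norm k n (\<lambda>i. A i * (of_bool (\<omega> i) - tensor_mean (bernoulli_tensor k n p) i))
                > C * max_norm k n A * sqrt (real N * Max (p ` multi_index k n))}
         \<le> real N powr (- r)"
      unfolding P_def D_def a_def by (simp add: q_def R_def)
  qed
qed

end
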